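(* Let $n\geq 3$ and let $T$ be an $n$-branch piecewise linear expanding map. Then the number of Lyapunov inflections of $T$ is less than or equal to $\frac{n(n-1)(n+4)}{6}$.
   Context: An $n$-branch piecewise linear expanding map is a map $T: X=\bigcup_{i=1}^n X_i\to[0,1]$, where $X_1,\dots,X_n\subset[0,1]$ are closed intervals with pairwise disjoint interiors, each $T|_{X_i}$ is affine and maps $X_i$ onto $[0,1]$, and $|T'|=x_i:=|X_i|^{-1}>1$ on $X_i$ (the numbers $x_i$ are called the slopes; ambiguities at common endpoints are irrelevant). Indices are arranged so that $1<x_1\le x_2\le\cdots\le x_n$; slopes may coincide. The repeller is $\Lambda=\bigcap_{k\ge 0}T^{-k}(X)$. The Lyapunov exponent at $x\in\Lambda$ is $\lambda(x)=\lim_{m\to\infty}\frac1m\log|(T^m)'(x)|$ when the limit exists. The Lyapunov spectrum is $L(\alpha)=\dim_H\{x\in\Lambda:\lambda(x)=\alpha\}$ (Hausdorff dimension), defined for those $\alpha$ with nonempty level set; its domain is $[\log x_1,\log x_n]$. A Lyapunov inflection of $T$ is a point $\alpha\in(\log x_1,\log x_n)$ with $L''(\alpha)=0$. If the slopes are not all equal, put $F(t)=\sum_{i=1}^n x_i^t$. Then $\alpha(t)=F'(t)/F(t)$ is an increasing bijection from $\mathbb{R}$ onto $(\log x_1,\log x_n)$, and $L(\alpha(t))=\frac{F(t)\log F(t)}{F'(t)}-t$. *)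

theory Defs
  imports "HOL-Analysis.Analysis"
begin

definition hausdorff_measure :: "real \<Rightarrow> 'a::euclidean_space set \<Rightarrow> ennreal" where
  "hausdorff_measure s A =
     (SUP \<delta>\<in>{0<..}.
        INF U\<in>{U :: nat \<Rightarrow> 'a set. A \<subseteq> (\<Union>i. U i) \<and> (\<forall>i. bounded (U i) \<and> diameter (U i) \<le> \<delta>)}.
          (\<Sum>i. ennreal (diameter (U i) powr s)))"

text \<open>The infimum is over positive \<open>s\<close> only, which gives the same value as \<open>s \<ge> 0\<close> for a
  nonempty set and avoids \<open>0 powr 0 = 0\<close>, under which \<open>hausdorff_measure 0\<close> would not be counting
  measure. The set of such \<open>s\<close> contains every \<open>s > DIM('a)\<close>; the empty set gets dimension 0.\<close>

definition hausdorff_dim :: "'a::euclidean_space set \<Rightarrow> real" where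
  "hausdorff_dim A = Inf {s. 0 < s \<and> hausdorff_measure s A = 0}"

text \<open>The branches are carried by the intervals \<open>X\<^sub>i = {a i..b i}\<close>, \<open>i = 1, \<dots>, n\<close>. The map is a total
  function \<open>T\<close> of which only the values on the union of the \<open>X\<^sub>i\<close> matter.\<close>

definition slope :: "(nat \<Rightarrow> real) \<Rightarrow> (nat \<Rightarrow> real) \<Rightarrow> nat \<Rightarrow> real" where
  "slope a b i = 1 / (b i - a i)"

definition branch_domain :: "nat \<Rightarrow> (nat \<Rightarrow> real) \<Rightarrow> (nat \<Rightarrow> real) \<Rightarrow> real set" where
  "branch_domain n a b = (\<Union>i\<in>{1..n}. {a i..b i})"

text \<open>The \<open>i\<close>-th branch is \<open>x \<mapsto> c i * x + d i\<close>. At a point common to two intervals \<open>T\<close> may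
  take the value of either branch; at every other point of \<open>X\<^sub>i\<close> it takes the value of the \<open>i\<close>-th one.\<close>

definition pl_expanding_map ::
  "nat \<Rightarrow> (nat \<Rightarrow> real) \<Rightarrow> (nat \<Rightarrow> real) \<Rightarrow> (real \<Rightarrow> real) \<Rightarrow> bool" where
  "pl_expanding_map n a b T \<longleftrightarrow>
     (\<forall>i\<in>{1..n}. a i < b i \<and> {a i..b i} \<subseteq> {0..1}) \<and>
     disjoint_family_on (\<lambda>i. interior {a i..b i}) {1..n} \<and>
     (\<forall>i\<in>{1..n}. 1 < slope a b i) \<and>
     (\<forall>i\<in>{1..n}. \<forall>j\<in>{1..n}. i \<le> j \<longrightarrow> slope a b i \<le> slope a b j) \<and>
     (\<exists>c d :: nat \<Rightarrow> real.
        (\<forall>i\<in>{1..n}. (\<lambda>x. c i * x + d i) ` {a i..b i} = {0..1}) \<and>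
        (\<forall>x\<in>branch_domain n a b. \<exists>i\<in>{1..n}. x \<in> {a i..b i} \<and> T x = c i * x + d i))"

definition repeller :: "real set \<Rightarrow> (real \<Rightarrow> real) \<Rightarrow> real set" where
  "repeller X T = (\<Inter>k. (T ^^ k) -` X)"

definition iterate_domain :: "real set \<Rightarrow> (real \<Rightarrow> real) \<Rightarrow> nat \<Rightarrow> real set" where
  "iterate_domain X T m = {x. \<forall>k<m. (T ^^ k) x \<in> X}"

text \<open>Derivatives are taken within the domain of \<open>T ^^ m\<close>, hence are one-sided at its boundary
  points. For the maps above this domain has no isolated points, so \<open>D\<close> is unique. The exponent
  is not defined at a point where some iterate is not differentiable; there are only countably
  many such points, all of them preimages of common endpoints.\<close>

definition has_lyapunov_exponent :: "real set \<Rightarrow> (real \<Rightarrow> real) \<Rightarrow> real \<Rightarrow> real \<Rightarrow> bool" where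
  "has_lyapunov_exponent X T x \<alpha> \<longleftrightarrow>
     (\<exists>D :: nat \<Rightarrow> real.
        (\<forall>m. ((T ^^ m) has_real_derivative D m) (at x within iterate_domain X T m)) \<and>
        (\<lambda>m. 1 / real m * ln \<bar>D m\<bar>) \<longlonglongrightarrow> \<alpha>)"

definition lyapunov_spectrum :: "real set \<Rightarrow> (real \<Rightarrow> real) \<Rightarrow> real \<Rightarrow> real" where
  "lyapunov_spectrum X T \<alpha> = hausdorff_dim {x \<in> repeller X T. has_lyapunov_exponent X T x \<alpha>}"

definition has_second_derivative :: "(real \<Rightarrow> real) \<Rightarrow> real \<Rightarrow> real \<Rightarrow> bool" where
  "has_second_derivative f y x \<longleftrightarrow>
     (\<exists>f'. (\<forall>\<^sub>F z in nhds x. (f has_real_derivative f' z) (at z)) \<and>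
           (f' has_real_derivative y) (at x))"

definition lyapunov_inflections ::
  "nat \<Rightarrow> (nat \<Rightarrow> real) \<Rightarrow> (nat \<Rightarrow> real) \<Rightarrow> (real \<Rightarrow> real) \<Rightarrow> real set" where
  "lyapunov_inflections n a b T =
     {\<alpha>. ln (slope a b 1) < \<alpha> \<and> \<alpha> < ln (slope a b n) \<and>
          has_second_derivative (lyapunov_spectrum (branch_domain n a b) T) 0 \<alpha>}"

end

theory Submission
  imports Defs "HOL-Probability.Probability"
begin

text \<open>Put \<open>P = ln F\<close>, so that \<open>\<alpha> = P'\<close>. The formula \<open>L(\<alpha>(t)) = P(t) / \<alpha>(t) - t\<close> comes from the Bernoulli
  measure with weights \<open>exp (t ln x\<^sub>i - P(t))\<close>: a typical cylinder of length \<open>\<delta>\<close> has measure about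
  \<open>\<delta>\<close> to the power \<open>P(t) / \<alpha>(t) - t\<close>. Counting typical words bounds the dimension from above; from
  below, a Chernoff bound and the Borel-Cantelli lemma show that almost every word is typical, and a
  set of diameter \<open>\<delta>\<close> meets only boundedly many cylinders of length about \<open>\<delta>\<close>.

  Differentiating, \<open>\<alpha>(t)\<close> is an inflection only if \<open>G = 2 P - P'\<^sup>2 / P''\<close> vanishes at \<open>t\<close>. Now
  \<open>G' = P'\<^sup>2 P''' / P''\<^sup>2\<close>, and \<open>F\<^sup>3 P'''\<close> is an exponential sum, not identically zero, whose exponents are the sums
  \<open>ln x\<^sub>i + ln x\<^sub>j + ln x\<^sub>k\<close> with \<open>i, j, k\<close> not all equal: at most \<open>n (n - 1) + (n choose 3)\<close> of them.
  An exponential sum has fewer zeros than exponents, and by Rolle \<open>G\<close> has at most one zero more than \<open>G'\<close>.\<close>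

section \<open>Zeros of exponential sums\<close>

text \<open>The formula for L is derived from the definition of Hausdorff dimension, which takes
  most of the work. The obstacle is that digit codes are ambiguous at common endpoints, where
  \<open>T\<close> may also take either branch. This ambiguity is confined to the countable set
  \<open>endpoints\<close>, which is null in every positive dimension: the upper bound covers it at
  no cost, the lower bound adds it to the set to be covered. The Bernoulli measure stays on the
  space of digit sequences; a cover of the level set is translated into cylinder events, whose
  probabilities are explicit. An exponential sum has strictly fewer zeros than exponents, and this
  difference of one pays for the extra zero allowed by Rolle. So the final bound is the number of
  exponents itself, n (n - 1) + n (n - 1) (n - 2) / 6 = n (n - 1) (n + 4) / 6.\<close>

lemma card_zeros_le_Suc_card_zeros_deriv:
  fixes f f' :: "real \<Rightarrow> real"
  assumes der: "\<And>t. (f has_real_derivative f' t) (at t)"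
    and fin: "finite {t. f' t = 0}"
  shows "finite {t. f t = 0} \<and> card {t. f t = 0} \<le> Suc (card {t. f' t = 0})"
proof -
  \<comment> \<open>Finiteness of the zero set is itself to be proved, so Rolle is applied to an
    arbitrary finite set \<open>S\<close> of zeros. Each element but the largest has a successor in
    \<open>S\<close>, and the gaps between successive elements are disjoint.\<close>
  have *: "card S \<le> Suc (card {t. f' t = 0})" if S: "finite S" "S \<subseteq> {t. f t = 0}" for S
  proof (cases "S = {}")
    case False
    define S' where "S' = S - {Max S}"
    define nxt where "nxt s = Min {u \<in> S. s < u}" for s
    have nxt: "nxt s \<in> S" "s < nxt s" "\<And>u. u \<in> S \<Longrightarrow> s < u \<Longrightarrow> nxt s \<le> u" if "s \<in> S'" for s
    proof -
      have "s < Max S"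
        using that S(1) unfolding S'_def by (metis Diff_iff Max_ge insertI1 order_le_imp_less_or_eq)
      then have ne: "{u \<in> S. s < u} \<noteq> {}" using Max_in[OF S(1) False] by blast
      have fi: "finite {u \<in> S. s < u}" using S by simp
      from Min_in[OF fi ne] show "nxt s \<in> S" "s < nxt s" by (auto simp: nxt_def)
      show "nxt s \<le> u" if "u \<in> S" "s < u" for u
        unfolding nxt_def using that fi by (intro Min_le) auto
    qed
    have "\<exists>z. s < z \<and> z < nxt s \<and> f' z = 0" if s: "s \<in> S'" for s
    proof -
      have "f s = 0" "f (nxt s) = 0" using s nxt(1)[OF s] S(2) by (auto simp: S'_def)
      then have eq: "f s = f (nxt s)" by simp
      have "\<exists>z. s < z \<and> z < nxt s \<and> DERIV f z :> 0"
      proof (rule Rolle[OF nxt(2)[OF s] eq])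
        show "continuous_on {s..nxt s} f"
          by (rule DERIV_continuous_on[OF has_field_derivative_at_within[OF der]])
        show "f differentiable (at x)" for x
          using der[of x] by (auto simp: real_differentiable_def)
      qed
      then show ?thesis by (metis DERIV_unique der)
    qed
    then obtain z where z: "\<And>s. s \<in> S' \<Longrightarrow> s < z s \<and> z s < nxt s \<and> f' (z s) = 0"
      by metis
    have lt: "z s < z s'" if "s \<in> S'" "s' \<in> S'" "s < s'" for s s'
      using z[OF that(1)] z[OF that(2)] nxt(3)[OF that(1), of s'] that by (auto simp: S'_def)
    have "inj_on z S'"
      by (rule inj_onI) (metis lt less_irrefl linorder_neqE)
    then have "card S' \<le> card {t. f' t = 0}"
      using z by (intro card_inj_on_le fin) auto
    then show ?thesis using S(1) False by (simp add: S'_def)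
  qed simp
  have "finite {t. f t = 0}"
  proof (rule ccontr)
    assume "infinite {t. f t = 0}"
    from infinite_arbitrarily_large[OF this] obtain B where
      "finite B" "card B = Suc (Suc (card {t. f' t = 0}))" "B \<subseteq> {t. f t = 0}" by metis
    with *[of B] show False by simp
  qed
  with *[of "{t. f t = 0}"] show ?thesis by simp
qed

text \<open>Induction on the number of exponents: division by \<open>exp (e0 * t)\<close> turns one
  term into a constant, which differentiation removes at the price of one zero. Indexing
  coefficients by the exponents makes the exponents distinct; since coefficients may be 0,
  nontriviality is expressed by a nonzero value at \<open>t0\<close>.\<close>

lemma card_zeros_exponential_sum:
  fixes c :: "real \<Rightarrow> real"
  assumes "finite E" and "(\<Sum>e\<in>E. c e * exp (e * t0)) \<noteq> 0"
  shows "finite {t. (\<Sum>e\<in>E. c e * exp (e * t)) = 0} \<and>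
         card {t. (\<Sum>e\<in>E. c e * exp (e * t)) = 0} < card E"
  using assms
proof (induction "card E" arbitrary: E c t0)
  case 0
  then show ?case by simp
next
  case (Suc k)
  then obtain e0 where e0: "e0 \<in> E" by fastforce
  define E' where "E' = (\<lambda>e. e - e0) ` (E - {e0})"
  define g where "g t = (\<Sum>e\<in>E. c e * exp ((e - e0) * t))" for t
  define g' where "g' t = (\<Sum>e\<in>E'. (c (e + e0) * e) * exp (e * t))" for t
  have fE: "finite E" and finE': "finite E'" using Suc by (auto simp: E'_def)
  have inj: "inj_on (\<lambda>e. e - e0) (E - {e0})" by (auto simp: inj_on_def)
  have cardE': "card E' = k"
    using Suc.hyps(2) e0 fE unfolding E'_def by (simp add: card_image[OF inj])
  have eq: "(\<Sum>e\<in>E. c e * exp (e * t)) = exp (e0 * t) * g t" for t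
    unfolding g_def sum_distrib_left
    by (intro sum.cong) (auto simp: algebra_simps exp_add[symmetric])
  have zeros: "{t. (\<Sum>e\<in>E. c e * exp (e * t)) = 0} = {t. g t = 0}"
    by (simp add: eq)
  have der: "(g has_real_derivative g' t) (at t)" for t
  proof -
    have "(g has_real_derivative (\<Sum>e\<in>E. c e * (exp ((e - e0) * t) * (e - e0)))) (at t)"
      unfolding g_def by (auto intro!: derivative_eq_intros sum.cong simp: mult_ac)
    also have "(\<Sum>e\<in>E. c e * (exp ((e - e0) * t) * (e - e0))) =
               (\<Sum>e\<in>E - {e0}. c e * (exp ((e - e0) * t) * (e - e0)))"
      using fE by (intro sum.mono_neutral_right) auto
    also have "\<dots> = g' t"
      unfolding g'_def E'_def by (simp add: sum.reindex[OF inj] mult_ac)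
    finally show ?thesis .
  qed
  show ?case
  \<comment> \<open>If the derivative vanishes identically, the induction hypothesis says nothing,
    but then \<open>g\<close> is a nonzero constant and has no zeros.\<close>
  proof (cases "\<exists>t1. g' t1 \<noteq> 0")
    case True
    then obtain t1 where t1: "(\<Sum>e\<in>E'. (c (e + e0) * e) * exp (e * t1)) \<noteq> 0"
      by (auto simp: g'_def)
    from Suc.hyps(1)[OF cardE'[symmetric] finE' t1]
    have g': "finite {t. g' t = 0}" "card {t. g' t = 0} < k"
      by (simp_all add: g'_def[symmetric] cardE')
    show ?thesis
      using card_zeros_le_Suc_card_zeros_deriv[OF der g'(1)] g'(2) Suc.hyps(2)
      unfolding zeros by linarith
  next
    case False
    then have "g t = g t0" for t
      using DERIV_isconst_all[of g t t0] der by metis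
    moreover have "g t0 \<noteq> 0" using Suc.prems(2) eq by auto
    ultimately have "{t. g t = 0} = {}" by (metis (mono_tags) empty_Collect_eq)
    then show ?thesis using Suc.hyps(2) unfolding zeros by simp
  qed
qed

text \<open>Terms with equal exponents are merged, so only distinct exponents are counted and
  coincidences among the \<open>m i\<close> can only help.\<close>

lemma card_zeros_exponential_sum_image:
  fixes c m :: "'i \<Rightarrow> real"
  assumes "finite J" and "(\<Sum>i\<in>J. c i * exp (m i * t0)) \<noteq> 0"
  shows "finite {t. (\<Sum>i\<in>J. c i * exp (m i * t)) = 0} \<and>
         card {t. (\<Sum>i\<in>J. c i * exp (m i * t)) = 0} < card (m ` J)"
proof -
  have eq: "(\<Sum>i\<in>J. c i * exp (m i * t)) =
        (\<Sum>e\<in>m ` J. (\<Sum>i\<in>{i\<in>J. m i = e}. c i) * exp (e * t))" for t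
    unfolding sum.image_gen[OF assms(1), of "\<lambda>i. c i * exp (m i * t)" m]
    by (auto simp: sum_distrib_right intro!: sum.cong)
  show ?thesis
    using card_zeros_exponential_sum[of "m ` J" "\<lambda>e. \<Sum>i\<in>{i\<in>J. m i = e}. c i" t0] assms unfolding eq by blast
qed

section \<open>The pressure function\<close>

locale pressure =
  fixes I :: "'i set" and l :: "'i \<Rightarrow> real"
  assumes fin: "finite I"
    and pos: "\<And>i. i \<in> I \<Longrightarrow> 0 < l i"
    and nonconst: "\<exists>i\<in>I. \<exists>j\<in>I. l i \<noteq> l j"
begin

text \<open>With \<open>l i\<close> = ln x_i this is the k-th derivative of F.\<close>

definition M :: "nat \<Rightarrow> real \<Rightarrow> real" where
  "M k t = (\<Sum>i\<in>I. l i ^ k * exp (l i * t))"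

text \<open>The numerator of P'' = (F'' F - F'^2) / F^2.\<close>

definition V :: "real \<Rightarrow> real" where
  "V t = M 2 t * M 0 t - (M 1 t)\<^sup>2"

lemma I_ne: "I \<noteq> {}" using nonconst by auto

lemma M_pos: "0 < M k t"
  unfolding M_def by (intro sum_pos fin I_ne) (auto simp: pos)

lemma M_deriv: "(M k has_real_derivative M (Suc k) t) (at t)"
  unfolding M_def by (auto intro!: derivative_eq_intros sum.cong simp: field_simps)

lemma M_derivs:
  "(M 0 has_real_derivative M 1 t) (at t)"
  "(M 1 has_real_derivative M 2 t) (at t)"
  "(M 2 has_real_derivative M 3 t) (at t)"
  using M_deriv[of 0 t] M_deriv[of 1 t] M_deriv[of 2 t] by (simp_all add: eval_nat_numeral)

text \<open>Lagrange's identity: \<open>2 * V t\<close> is a double sum of squared differences with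
  positive weights, and two different values of \<open>l\<close> make one of them positive.\<close>

lemma V_pos: "0 < V t"
proof -
  let ?e = "\<lambda>i. exp (l i * t)"
  have "2 * V t = (\<Sum>i\<in>I. \<Sum>j\<in>I. (l i - l j)\<^sup>2 * (?e i * ?e j))"
  proof -
    have a: "(\<Sum>i\<in>I. \<Sum>j\<in>I. (l i ^ 2 * ?e i) * ?e j) = M 2 t * M 0 t"
      by (simp add: M_def sum_product)
    have b: "(\<Sum>i\<in>I. \<Sum>j\<in>I. ?e i * (l j ^ 2 * ?e j)) = M 0 t * M 2 t"
      by (simp add: M_def sum_product)
    have c: "(\<Sum>i\<in>I. \<Sum>j\<in>I. 2 * ((l i * ?e i) * (l j * ?e j))) = 2 * (M 1 t * M 1 t)"
      unfolding M_def power_one_right sum_product by (simp only: sum_distrib_left)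
    have "(\<Sum>i\<in>I. \<Sum>j\<in>I. (l i - l j)\<^sup>2 * (?e i * ?e j)) =
      (\<Sum>i\<in>I. \<Sum>j\<in>I. (l i ^ 2 * ?e i) * ?e j + ?e i * (l j ^ 2 * ?e j)
          - 2 * ((l i * ?e i) * (l j * ?e j)))"
      by (intro sum.cong refl) (simp add: power2_eq_square algebra_simps)
    also have "\<dots> = M 2 t * M 0 t + M 0 t * M 2 t - 2 * (M 1 t * M 1 t)"
      unfolding sum_subtractf sum.distrib a b c ..
    finally show ?thesis by (simp add: V_def power2_eq_square)
  qed
  moreover have "0 < (\<Sum>i\<in>I. \<Sum>j\<in>I. (l i - l j)\<^sup>2 * (?e i * ?e j))"
  proof -
    obtain i j where ij: "i \<in> I" "j \<in> I" "l i \<noteq> l j" using nonconst by auto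
    have row: "0 < (\<Sum>j\<in>I. (l i - l j)\<^sup>2 * (?e i * ?e j))"
      using ij by (intro sum_pos2[OF fin ij(2)]) auto
    show ?thesis by (rule sum_pos2[OF fin ij(1), of "\<lambda>i. \<Sum>j\<in>I. (l i - l j)\<^sup>2 * (?e i * ?e j)", OF row])
        (simp add: sum_nonneg)
  qed
  ultimately show ?thesis by simp
qed

section \<open>The pressure P and its first three derivatives\<close>

definition prs :: "real \<Rightarrow> real" where "prs t = ln (M 0 t)"

text \<open>\<open>mean\<close> and \<open>var\<close> are P' and P'': the mean and the variance of
  \<open>l\<close> under the weights \<open>exp (l i * t)\<close> / F(t).\<close>

definition mean :: "real \<Rightarrow> real" where "mean t = M 1 t / M 0 t"

definition var :: "real \<Rightarrow> real" where "var t = V t / (M 0 t)\<^sup>2"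

text \<open>This is F^3 P''', that is, F^3 times the third cumulant of \<open>l\<close> under the
  same weights.\<close>

definition K :: "real \<Rightarrow> real" where
  "K t = M 3 t * (M 0 t)\<^sup>2 - 3 * M 0 t * M 1 t * M 2 t + 2 * (M 1 t) ^ 3"

lemma mean_pos: "0 < mean t" by (simp add: mean_def M_pos)

lemma var_pos: "0 < var t" using M_pos[of 0 t] by (simp add: var_def V_pos)

lemma prs_deriv: "(prs has_real_derivative mean t) (at t)"
  unfolding prs_def mean_def using M_pos[of 0 t] M_deriv[of 0 t]
  by (auto intro!: derivative_eq_intros simp: field_simps)

lemma mean_deriv: "(mean has_real_derivative var t) (at t)"
proof -
  have ne: "M 0 t \<noteq> 0" using M_pos[of 0 t] by simp
  have "((\<lambda>t. M 1 t / M 0 t) has_real_derivative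
      (M 2 t * M 0 t - M 1 t * M 1 t) / (M 0 t * M 0 t)) (at t)"
    by (rule DERIV_divide M_derivs ne)+
  then show ?thesis by (simp add: mean_def[abs_def] var_def V_def power2_eq_square)
qed

lemma V_deriv: "(V has_real_derivative (M 3 t * M 0 t - M 1 t * M 2 t)) (at t)"
proof -
  have "((\<lambda>t. M 2 t * M 0 t - M 1 t * M 1 t) has_real_derivative
      (M 3 t * M 0 t + M 1 t * M 2 t) - (M 2 t * M 1 t + M 2 t * M 1 t)) (at t)"
    by (rule DERIV_diff DERIV_mult M_derivs)+
  then show ?thesis by (simp add: V_def[abs_def] power2_eq_square mult_ac)
qed

lemma var_deriv: "(var has_real_derivative K t / (M 0 t) ^ 3) (at t)"
proof -
  have ne: "M 0 t * M 0 t \<noteq> 0" using M_pos[of 0 t] by simp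
  \<comment> \<open>The quotient rule produces the denominator \<open>(M 0 t) ^ 4\<close>; one
    factor \<open>M 0 t\<close> cancels.\<close>
  have alg: "((c * m - a * b) * (m * m) - (b * m - a\<^sup>2) * (a * m + a * m)) / ((m * m) * (m * m)) =
      (c * m\<^sup>2 - 3 * m * a * b + 2 * a ^ 3) / m ^ 3" if "m \<noteq> 0" for a b c m :: real
    using that by (simp add: divide_simps) (simp add: algebra_simps power2_eq_square power3_eq_cube)
  have "((\<lambda>t. V t / (M 0 t * M 0 t)) has_real_derivative
      ((M 3 t * M 0 t - M 1 t * M 2 t) * (M 0 t * M 0 t) -
        V t * (M 1 t * M 0 t + M 1 t * M 0 t)) / ((M 0 t * M 0 t) * (M 0 t * M 0 t))) (at t)"
    by (rule DERIV_divide DERIV_mult M_derivs V_deriv ne)+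
  then show ?thesis
    using ne unfolding V_def[of t] K_def
    by (subst (asm) alg) (simp_all add: var_def[abs_def] power2_eq_square)
qed

text \<open>Otherwise P'' would be a positive constant, and P' would be affine with positive slope
  and have a root, contrary to \<open>mean_pos\<close>.\<close>

lemma K_nonzero: "\<exists>t. K t \<noteq> 0"
proof (rule ccontr)
  assume "\<not> ?thesis"
  then have "(var has_real_derivative 0) (at t)" for t using var_deriv[of t] by simp
  then have const: "var t = var 0" for t using DERIV_isconst_all[of var t 0] by blast
  have "((\<lambda>t. mean t - var 0 * t) has_real_derivative 0) (at t)" for t
    using const[of t] by (auto intro!: derivative_eq_intros mean_deriv)
  then have "mean t - var 0 * t = mean 0 - var 0 * 0" for t
    using DERIV_isconst_all[of "\<lambda>t. mean t - var 0 * t" t 0] by blast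
  from this[of "- mean 0 / var 0"] have "mean (- mean 0 / var 0) = 0"
    using var_pos[of 0] by simp
  then show False using mean_pos[of "- mean 0 / var 0"] by simp
qed

text \<open>The three products in \<open>K\<close> are expanded over the same index set of triples.
  On the diagonal the coefficient is (1 - 3 + 2) times a cube, so these triples drop out.\<close>

lemma K_eq_sum:
  "K t = (\<Sum>(i,j,k)\<in>{(i,j,k) \<in> I \<times> I \<times> I. \<not> (i = j \<and> j = k)}.
       (l k ^ 3 - 3 * l j * l k ^ 2 + 2 * l i * l j * l k) * exp ((l i + l j + l k) * t))"
proof -
  have tri: "(\<Sum>i\<in>I. f i) * (\<Sum>i\<in>I. g i) * (\<Sum>i\<in>I. h i) =
      (\<Sum>(i,j,k)\<in>I \<times> I \<times> I. f i * g j * h k)" for f g h :: "'i \<Rightarrow> real"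
  proof -
    have "(\<Sum>i\<in>I. f i) * (\<Sum>i\<in>I. g i) * (\<Sum>i\<in>I. h i) =
        (\<Sum>i\<in>I. (\<Sum>j\<in>I. f i * g j) * (\<Sum>k\<in>I. h k))"
      unfolding sum_product[of f I g I] by (rule sum_distrib_right)
    also have "\<dots> = (\<Sum>i\<in>I. \<Sum>j\<in>I. \<Sum>k\<in>I. f i * g j * h k)"
      by (simp only: sum_product)
    finally show ?thesis by (simp add: sum.cartesian_product)
  qed
  have "K t = M 0 t * M 0 t * M 3 t - 3 * (M 0 t * M 1 t * M 2 t) + 2 * (M 1 t * M 1 t * M 1 t)"
    by (simp add: K_def power2_eq_square power3_eq_cube mult_ac)
  also have "\<dots> = (\<Sum>(i,j,k)\<in>I \<times> I \<times> I.
       (l k ^ 3 - 3 * l j * l k ^ 2 + 2 * l i * l j * l k) * exp ((l i + l j + l k) * t))"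
    unfolding M_def tri unfolding sum_distrib_left sum_subtractf[symmetric] sum.distrib[symmetric]
    by (intro sum.cong) (auto simp: algebra_simps exp_add power2_eq_square power3_eq_cube)
  also have "\<dots> = (\<Sum>(i,j,k)\<in>{(i,j,k) \<in> I \<times> I \<times> I. \<not> (i = j \<and> j = k)}.
       (l k ^ 3 - 3 * l j * l k ^ 2 + 2 * l i * l j * l k) * exp ((l i + l j + l k) * t))"
    using fin by (intro sum.mono_neutral_right) (auto simp: power2_eq_square power3_eq_cube)
  finally show ?thesis .
qed

text \<open>The exponent depends only on the multiset {i, j, k}. A repeated index leaves an ordered
  pair of distinct indices, with exponent \<open>2 * l i + l j\<close>; three different indices form
  a 3-subset of \<open>I\<close>.\<close>

lemma card_zeros_K:
  "finite {t. K t = 0} \<and>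
   card {t. K t = 0} < card I * (card I - 1) + (card I choose 3)"
proof -
  define J where "J = {(i,j,k) \<in> I \<times> I \<times> I. \<not> (i = j \<and> j = k)}"
  define c where "c = (\<lambda>(i,j,k). l k ^ 3 - 3 * l j * l k ^ 2 + 2 * l i * l j * l k)"
  define m where "m = (\<lambda>(i,j,k). l i + l j + l k)"
  have K: "K t = (\<Sum>x\<in>J. c x * exp (m x * t))" for t
    unfolding K_eq_sum J_def by (intro sum.cong) (auto simp: c_def m_def)
  have finJ: "finite J" unfolding J_def
    by (rule finite_subset[of _ "I \<times> I \<times> I"]) (use fin in auto)
  define P where "P = {(i,j). i \<in> I \<and> j \<in> I \<and> i \<noteq> j}"
  define S where "S = {A. A \<subseteq> I \<and> card A = 3}"
  have P_eq: "P = (SIGMA i:I. I - {i})" by (auto simp: P_def)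
  have finP: "finite P" and cardP: "card P = card I * (card I - 1)"
    using fin by (simp_all add: P_eq)
  have finS: "finite S" and cardS: "card S = card I choose 3"
    using fin by (simp_all add: S_def n_subsets)
  have sub: "m ` J \<subseteq> (\<lambda>(i,j). 2 * l i + l j) ` P \<union> (\<lambda>A. \<Sum>i\<in>A. l i) ` S"
  proof
    fix x assume "x \<in> m ` J"
    then obtain i j k where ijk: "i \<in> I" "j \<in> I" "k \<in> I" "\<not> (i = j \<and> j = k)"
      and x: "x = l i + l j + l k" by (auto simp: J_def m_def)
    consider "i = j" "j \<noteq> k" | "i = k" "i \<noteq> j" | "j = k" "i \<noteq> j" | "i \<noteq> j" "i \<noteq> k" "j \<noteq> k"
      using ijk by blast
    then show "x \<in> (\<lambda>(i,j). 2 * l i + l j) ` P \<union> (\<lambda>A. \<Sum>i\<in>A. l i) ` S"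
    proof cases
      case 1 then show ?thesis using ijk x
        by (intro UnI1 image_eqI[of _ _ "(i,k)"]) (auto simp: P_def)
    next
      case 2 then show ?thesis using ijk x
        by (intro UnI1 image_eqI[of _ _ "(i,j)"]) (auto simp: P_def)
    next
      case 3 then show ?thesis using ijk x
        by (intro UnI1 image_eqI[of _ _ "(j,i)"]) (auto simp: P_def)
    next
      case 4 then show ?thesis using ijk x
        by (intro UnI2 image_eqI[of _ _ "{i,j,k}"]) (auto simp: S_def)
    qed
  qed
  obtain t0 where "K t0 \<noteq> 0" using K_nonzero by blast
  then have t0: "(\<Sum>x\<in>J. c x * exp (m x * t0)) \<noteq> 0" by (simp add: K)
  have "card (m ` J) \<le> card ((\<lambda>(i,j). 2 * l i + l j) ` P \<union> (\<lambda>A. \<Sum>i\<in>A. l i) ` S)"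
    using sub finP finS by (intro card_mono) auto
  also have "\<dots> \<le> card ((\<lambda>(i,j). 2 * l i + l j) ` P) + card ((\<lambda>A. \<Sum>i\<in>A. l i) ` S)"
    by (rule card_Un_le)
  also have "\<dots> \<le> card P + card S"
    using finP finS by (intro add_mono card_image_le)
  finally have "card (m ` J) \<le> card I * (card I - 1) + (card I choose 3)"
    by (simp add: cardP cardS)
  with card_zeros_exponential_sum_image[OF finJ t0] show ?thesis
    unfolding K by linarith
qed

text \<open>The equation is divided by \<open>var t\<close> before differentiating: in the
  derivative of 2 P - P'^2 / P'' the two terms 2 P' cancel, which leaves a positive multiple of
  \<open>K\<close>.\<close>

lemma card_zeros_infl:
  "finite {t. 2 * prs t * var t = (mean t)\<^sup>2} \<and>
   card {t. 2 * prs t * var t = (mean t)\<^sup>2} \<le> card I * (card I - 1) + (card I choose 3)"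
proof -
  define G where "G t = 2 * prs t - (mean t)\<^sup>2 / var t" for t
  define G' where "G' t = (mean t)\<^sup>2 * (K t / (M 0 t) ^ 3) / (var t)\<^sup>2" for t
  have der: "(G has_real_derivative G' t) (at t)" for t
  proof -
    have "var t \<noteq> 0" using var_pos[of t] by simp
    then show ?thesis unfolding G_def G'_def
      by (auto intro!: derivative_eq_intros prs_deriv mean_deriv var_deriv)
         (simp add: field_simps power2_eq_square)
  qed
  have G: "G t = 0 \<longleftrightarrow> 2 * prs t * var t = (mean t)\<^sup>2" for t
    using var_pos[of t] by (auto simp: G_def field_simps)
  have G': "G' t = 0 \<longleftrightarrow> K t = 0" for t
    using var_pos[of t] mean_pos[of t] M_pos[of 0 t] by (simp add: G'_def)
  show ?thesis
    using card_zeros_le_Suc_card_zeros_deriv[of G G', unfolded G G'] der card_zeros_K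
    by (meson Suc_leI le_trans)
qed

text \<open>The function \<open>h\<close> is
  \<open>exp (- \<beta> * t) * (M 1 t - \<beta> * M 0 t)\<close>, so it has the sign of
  \<open>mean t - \<beta>\<close>. Its sign is controlled at one explicit time on each side of 0,
  and a zero lies between.\<close>

lemma mean_surj:
  assumes i: "i \<in> I" "l i < \<beta>" and j: "j \<in> I" "\<beta> < l j"
  shows "\<exists>t. mean t = \<beta>"
proof -
  define h where "h t = (\<Sum>k\<in>I. (l k - \<beta>) * exp (t * (l k - \<beta>)))" for t
  define B where "B = (\<Sum>k\<in>I. \<bar>l k - \<beta>\<bar>)"
  have B: "0 \<le> B" by (auto simp: B_def intro: sum_nonneg)
  have bound: "u * exp (t * u) \<ge> - \<bar>u\<bar>" if "0 \<le> t" for t u :: real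
  proof (cases "0 \<le> u")
    case True then show ?thesis using that by (smt (verit) exp_gt_zero mult_nonneg_nonneg)
  next
    case False
    then have "exp (t * u) \<le> 1" using that by (simp add: mult_nonneg_nonpos)
    then have "u * 1 \<le> u * exp (t * u)" using False by (intro mult_left_mono_neg) auto
    then show ?thesis using False by linarith
  qed
  have grow: "u * u * t \<le> u * exp (t * u)" if "0 \<le> t" "0 < u" for t u :: real
  proof -
    have "u * t \<le> exp (t * u)" using exp_ge_add_one_self[of "t * u"] mult.commute[of t u] by linarith
    then show ?thesis using that by simp
  qed
  \<comment> \<open>Both ends at once, with \<open>s k\<close> equal to \<open>l k - \<beta>\<close>
    or to \<open>\<beta> - l k\<close>. Since \<open>exp (t * s k0)\<close> is at least
    \<open>t * s k0\<close>, the term of \<open>k0\<close> is at least t * (s k0)^2 = B, while the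
    other terms add up to at least - B.\<close>
  have key: "0 \<le> (\<Sum>k\<in>I. s k * exp (t * s k))"
    if s: "k0 \<in> I" "0 < s k0" "\<And>k. \<bar>s k\<bar> = \<bar>l k - \<beta>\<bar>" and t: "t = B / (s k0 * s k0)"
    for s :: "'i \<Rightarrow> real" and k0 t
  proof -
    have t0: "0 \<le> t" using t B s by simp
    have "(\<Sum>k\<in>I. s k * exp (t * s k)) = s k0 * exp (t * s k0) + (\<Sum>k\<in>I - {k0}. s k * exp (t * s k))"
      by (rule sum.remove[OF fin s(1)])
    moreover have "(\<Sum>k\<in>I - {k0}. s k * exp (t * s k)) \<ge> (\<Sum>k\<in>I - {k0}. - \<bar>s k\<bar>)"
      by (intro sum_mono bound t0)
    moreover have "(\<Sum>k\<in>I - {k0}. - \<bar>s k\<bar>) \<ge> - B"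
      unfolding B_def s(3) sum_negf using fin by (auto intro!: sum_mono2)
    moreover have "s k0 * exp (t * s k0) \<ge> B"
      using grow[OF t0 s(2)] t s(2) by simp
    ultimately show ?thesis by linarith
  qed
  have 1: "0 \<le> h (B / ((l j - \<beta>) * (l j - \<beta>)))"
    unfolding h_def by (rule key[OF j(1), of "\<lambda>k. l k - \<beta>"]) (use j in auto)
  have 2: "h (- (B / ((\<beta> - l i) * (\<beta> - l i)))) \<le> 0"
  proof -
    have "0 \<le> (\<Sum>k\<in>I. (\<beta> - l k) * exp (B / ((\<beta> - l i) * (\<beta> - l i)) * (\<beta> - l k)))"
      by (rule key[OF i(1), of "\<lambda>k. \<beta> - l k"]) (use i in auto)
    also have "\<dots> = - h (- (B / ((\<beta> - l i) * (\<beta> - l i))))"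
    proof -
      have "(\<beta> - l k) * exp (u * (\<beta> - l k)) = - ((l k - \<beta>) * exp (- u * (l k - \<beta>)))" for k u
        by (simp add: algebra_simps)
      then show ?thesis unfolding h_def sum_negf[symmetric] by (simp only:)
    qed
    finally show ?thesis by simp
  qed
  have "- (B / ((\<beta> - l i) * (\<beta> - l i))) \<le> 0"
    using B by (simp add: zero_le_mult_iff)
  moreover have "0 \<le> B / ((l j - \<beta>) * (l j - \<beta>))" using B by simp
  ultimately have "- (B / ((\<beta> - l i) * (\<beta> - l i))) \<le> B / ((l j - \<beta>) * (l j - \<beta>))"
    by (rule order_trans)
  moreover have "isCont h t" for t unfolding h_def by (intro continuous_intros)
  ultimately obtain t where t: "h t = 0" using IVT[of h _ 0] 1 2 by blast
  have "exp (\<beta> * t) * h t = M 1 t - \<beta> * M 0 t"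
    unfolding h_def M_def sum_distrib_left sum_subtractf[symmetric]
    by (intro sum.cong refl) (simp add: algebra_simps exp_add[symmetric])
  then have "M 1 t = \<beta> * M 0 t" using t by simp
  then show ?thesis using M_pos[of 0 t] by (auto simp: mean_def intro!: exI[of _ t])
qed

text \<open>With \<open>\<alpha> = P'\<close> and \<open>L(\<alpha>(t)) = P(t) / \<alpha>(t) - t\<close> the chain rule gives
  \<open>L'(\<alpha>(t)) = - P(t) / \<alpha>(t)\<^sup>2\<close> and \<open>L''(\<alpha>(t)) = (2 P P'' - P'\<^sup>2) / (P'\<^sup>3 P'')\<close>.\<close>

lemma inflection_imp:
  assumes L: "\<And>t. L (mean t) = prs t / mean t - t"
    and infl: "has_second_derivative L 0 (mean t)"
  shows "2 * prs t * var t = (mean t)\<^sup>2"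
proof -
  from infl obtain f' where
    f': "\<forall>\<^sub>F z in nhds (mean t). (L has_real_derivative f' z) (at z)"
    and f'': "(f' has_real_derivative 0) (at (mean t))"
    unfolding has_second_derivative_def by blast
  have "(mean \<longlongrightarrow> mean t) (nhds t)"
    using DERIV_isCont[OF mean_deriv] by (simp add: continuous_at tendsto_at_iff_tendsto_nhds)
  from eventually_compose_filterlim[OF f' this]
  have ev: "\<forall>\<^sub>F s in nhds t. (L has_real_derivative f' (mean s)) (at (mean s))" .
  \<comment> \<open>The derivative of \<open>L\<close> composed with \<open>mean\<close> is computed
    twice and divided by \<open>var s\<close>. This identifies \<open>f'\<close> along the curve
    without an inverse function of \<open>mean\<close>.\<close>
  have first: "\<forall>\<^sub>F s in nhds t. - prs s / (mean s)\<^sup>2 = f' (mean s)"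
    using ev
  proof eventually_elim
    case (elim s)
    have ne: "mean s \<noteq> 0" "var s \<noteq> 0" using mean_pos[of s] var_pos[of s] by auto
    have "((\<lambda>s. L (mean s)) has_real_derivative f' (mean s) * var s) (at s)"
      by (rule DERIV_chain2[OF elim mean_deriv])
    moreover have "((\<lambda>s. L (mean s)) has_real_derivative - prs s / (mean s)\<^sup>2 * var s) (at s)"
      unfolding L using ne
      by (auto intro!: derivative_eq_intros prs_deriv mean_deriv simp: field_simps power2_eq_square)
    ultimately have "f' (mean s) * var s = - prs s / (mean s)\<^sup>2 * var s"
      by (rule DERIV_unique)
    then show ?case using ne(2) by (metis mult_right_cancel)
  qed
  have ne: "mean t \<noteq> 0" "var t \<noteq> 0" using mean_pos[of t] var_pos[of t] by auto
  have "((\<lambda>s. f' (mean s)) has_real_derivative 0 * var t) (at t)"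
    by (rule DERIV_chain2[OF f'' mean_deriv])
  then have "((\<lambda>s. - prs s / (mean s)\<^sup>2) has_real_derivative 0) (at t)"
    using DERIV_cong_ev[OF refl first refl] by simp
  moreover have "((\<lambda>s. - prs s / (mean s)\<^sup>2) has_real_derivative
      (- mean t * (mean t * mean t) - (- prs t) * (var t * mean t + var t * mean t)) /
      ((mean t * mean t) * (mean t * mean t))) (at t)"
    unfolding power2_eq_square
    by (rule DERIV_divide DERIV_minus DERIV_mult prs_deriv mean_deriv)+ (use ne in simp)
  ultimately have "(- mean t * (mean t * mean t) - (- prs t) * (var t * mean t + var t * mean t)) /
      ((mean t * mean t) * (mean t * mean t)) = 0"
    by (rule DERIV_unique[symmetric])
  then have "mean t * (2 * prs t * var t - (mean t)\<^sup>2) = 0"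
    using ne by (simp add: algebra_simps power2_eq_square)
  then show ?thesis using ne by simp
qed

end

section \<open>Hausdorff null sets\<close>

text \<open>No mesh size appears: for s > 0 a small total forces every single set to be small. The
  numbers \<open>d i\<close> are only upper bounds for diameters, so they may be enlarged at
  will.\<close>

definition hausdorff_null :: "real \<Rightarrow> 'a::euclidean_space set \<Rightarrow> bool" where
  "hausdorff_null s A \<longleftrightarrow>
     (\<forall>\<eta>>0. \<exists>(U :: nat \<Rightarrow> 'a set) (d :: nat \<Rightarrow> real).
        A \<subseteq> (\<Union>i. U i) \<and> (\<forall>i. 0 \<le> d i) \<and> (\<forall>i. \<forall>x\<in>U i. \<forall>y\<in>U i. dist x y \<le> d i) \<and>
        (\<Sum>i. ennreal (d i powr s)) \<le> ennreal \<eta>)"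

lemma hausdorff_nullE:
  assumes "hausdorff_null s A" "0 < \<eta>"
  obtains U :: "nat \<Rightarrow> 'a::euclidean_space set" and d where "A \<subseteq> (\<Union>i. U i)" "\<forall>i. 0 \<le> d i"
    "\<forall>i. \<forall>x\<in>U i. \<forall>y\<in>U i. dist x y \<le> d i" "(\<Sum>i. ennreal (d i powr s)) \<le> ennreal \<eta>"
proof -
  note assms(1)[unfolded hausdorff_null_def, THEN spec, THEN mp, OF assms(2)]
  then show thesis by (elim exE conjE) (rule that)
qed

lemma hausdorff_measure_0_iff:
  fixes A :: "'a::euclidean_space set"
  assumes s: "0 < s"
  shows "hausdorff_measure s A = 0 \<longleftrightarrow> hausdorff_null s A"
proof
  assume 0: "hausdorff_measure s A = 0"
  show "hausdorff_null s A"
    unfolding hausdorff_null_def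
  proof (intro allI impI)
    fix \<eta> :: real assume \<eta>: "0 < \<eta>"
    let ?S = "\<lambda>\<delta>. {U :: nat \<Rightarrow> 'a set. A \<subseteq> (\<Union>i. U i) \<and> (\<forall>i. bounded (U i) \<and> diameter (U i) \<le> \<delta>)}"
    have "(INF U\<in>?S 1. (\<Sum>i. ennreal (diameter (U i) powr s))) \<le> hausdorff_measure s A"
      unfolding hausdorff_measure_def by (rule SUP_upper) simp
    also have "\<dots> < ennreal \<eta>" using 0 \<eta> by simp
    finally obtain U where U: "U \<in> ?S 1" "(\<Sum>i. ennreal (diameter (U i) powr s)) < ennreal \<eta>"
      unfolding INF_less_iff by blast
    then show "\<exists>U d. A \<subseteq> (\<Union>i. U i) \<and> (\<forall>i. 0 \<le> d i) \<and>
        (\<forall>i. \<forall>x\<in>U i. \<forall>y\<in>U i. dist x y \<le> d i) \<and> (\<Sum>i. ennreal (d i powr s)) \<le> ennreal \<eta>"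
      by (intro exI[of _ U] exI[of _ "\<lambda>i. diameter (U i)"])
         (auto intro: diameter_ge_0 diameter_bounded_bound)
  qed
next
  assume null: "hausdorff_null s A"
  have "(INF U\<in>{U :: nat \<Rightarrow> 'a set. A \<subseteq> (\<Union>i. U i) \<and> (\<forall>i. bounded (U i) \<and> diameter (U i) \<le> \<delta>)}.
          (\<Sum>i. ennreal (diameter (U i) powr s))) \<le> 0" if \<delta>: "0 < \<delta>" for \<delta>
  proof (rule ennreal_le_epsilon)
    fix e :: real assume e: "0 < e"
    \<comment> \<open>Each summand is at most the total, so the second entry makes every
      \<open>d i\<close> at most \<delta>.\<close>
    define \<eta> where "\<eta> = min e (\<delta> powr s)"
    have "0 < \<eta>" using e \<delta> by (simp add: \<eta>_def)
    then obtain U and d where U0: "A \<subseteq> (\<Union>i. U i)" "\<forall>i. 0 \<le> d i"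
        "\<forall>i. \<forall>x\<in>U i. \<forall>y\<in>U i. dist x y \<le> d i"
        "(\<Sum>i. ennreal (d i powr s)) \<le> ennreal \<eta>"
      by (rule hausdorff_nullE[OF null])
  have U: "A \<subseteq> (\<Union>i. U i)" "\<And>i. 0 \<le> d i"
        "\<And>i x y. x \<in> U i \<Longrightarrow> y \<in> U i \<Longrightarrow> dist x y \<le> d i"
        "(\<Sum>i. ennreal (d i powr s)) \<le> ennreal \<eta>"
      by (rule U0(1) U0(2)[rule_format] U0(3)[rule_format] U0(4); assumption)+
    have dle: "d i \<le> \<delta>" for i
    proof -
      have "ennreal (d i powr s) \<le> (\<Sum>i. ennreal (d i powr s))"
        by (rule leI) (auto dest: ennreal_suminf_lessD)
      with U(4) have "ennreal (d i powr s) \<le> ennreal \<eta>" by (rule order_trans[rotated])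
      then have "d i powr s \<le> \<delta> powr s" using \<open>0 < \<eta>\<close> by (simp add: \<eta>_def)
      then show ?thesis using powr_less_mono2[of s \<delta> "d i"] s \<delta> by linarith
    qed
    have bd: "bounded (U i)" for i
    proof (cases "U i = {}")
      case False
      then obtain x where "x \<in> U i" by blast
      then show ?thesis using U(3) unfolding bounded_def by blast
    qed simp
    have dia: "diameter (U i) \<le> d i" for i
      using U(2,3) by (intro diameter_le) (auto simp: dist_norm)
    have "(INF U\<in>{U :: nat \<Rightarrow> 'a set. A \<subseteq> (\<Union>i. U i) \<and> (\<forall>i. bounded (U i) \<and> diameter (U i) \<le> \<delta>)}.
          (\<Sum>i. ennreal (diameter (U i) powr s))) \<le> (\<Sum>i. ennreal (diameter (U i) powr s))"
      using U(1) bd order_trans[OF dia dle] by (intro INF_lower) auto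
    also have "\<dots> \<le> (\<Sum>i. ennreal (d i powr s))"
      using s dia bd by (intro suminf_le summableI ennreal_leI powr_mono2) (auto simp: diameter_ge_0)
    also have "\<dots> \<le> ennreal e" using U(4) by (rule order_trans) (auto simp: \<eta>_def intro: ennreal_leI)
    finally show "(INF U\<in>{U :: nat \<Rightarrow> 'a set. A \<subseteq> (\<Union>i. U i) \<and> (\<forall>i. bounded (U i) \<and> diameter (U i) \<le> \<delta>)}.
          (\<Sum>i. ennreal (diameter (U i) powr s))) \<le> 0 + ennreal e" by simp
  qed
  then show "hausdorff_measure s A = 0"
    unfolding hausdorff_measure_def by (simp add: SUP_eq_iff)
qed

lemma hausdorff_null_subset:
  assumes "hausdorff_null s B" "A \<subseteq> B"
  shows "hausdorff_null s A"
  using assms unfolding hausdorff_null_def by (meson order_trans)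

lemma suminf_ennreal_half_powers:
  assumes "0 \<le> \<eta>"
  shows "(\<Sum>k. ennreal (\<eta> * (1/2) ^ Suc k)) = ennreal \<eta>"
proof -
  have "(\<lambda>k. \<eta> * (1/2) ^ Suc k) sums (\<eta> * 1)" by (intro sums_mult power_half_series)
  then show ?thesis using assms by (intro suminf_ennreal_eq) auto
qed

lemma hausdorff_null_UN:
  fixes A :: "nat \<Rightarrow> 'a::euclidean_space set"
  assumes "\<And>k. hausdorff_null s (A k)"
  shows "hausdorff_null s (\<Union>k. A k)"
  unfolding hausdorff_null_def
proof (intro allI impI)
  fix \<eta> :: real assume \<eta>: "0 < \<eta>"
  have "\<exists>(U :: nat \<Rightarrow> 'a set) d. A k \<subseteq> (\<Union>i. U i) \<and> (\<forall>i. 0 \<le> d i) \<and>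
      (\<forall>i. \<forall>x\<in>U i. \<forall>y\<in>U i. dist x y \<le> d i) \<and>
      (\<Sum>i. ennreal (d i powr s)) \<le> ennreal (\<eta> * (1/2) ^ Suc k)" for k
    using assms[of k] \<eta> unfolding hausdorff_null_def by simp
  then obtain U :: "nat \<Rightarrow> nat \<Rightarrow> 'a set" and d where
    U: "\<And>k. A k \<subseteq> (\<Union>i. U k i)" "\<And>k i. 0 \<le> d k i"
      "\<And>k i. \<forall>x\<in>U k i. \<forall>y\<in>U k i. dist x y \<le> d k i"
      "\<And>k. (\<Sum>i. ennreal (d k i powr s)) \<le> ennreal (\<eta> * (1/2) ^ Suc k)"
    by metis
  define U' where "U' i = case_prod U (prod_decode i)" for i
  define d' where "d' i = case_prod d (prod_decode i)" for i
  have cov: "(\<Union>k. A k) \<subseteq> (\<Union>i. U' i)"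
  proof
    fix x assume "x \<in> (\<Union>k. A k)"
    then obtain k i where "x \<in> U k i" using U(1) by blast
    then have "x \<in> U' (prod_encode (k, i))" by (simp add: U'_def)
    then show "x \<in> (\<Union>i. U' i)" by blast
  qed
  have "(\<Sum>i. ennreal (d' i powr s)) =
      (\<Sum>i. (\<lambda>(k,i). ennreal (d k i powr s)) (prod_decode i))"
    by (simp add: d'_def split_beta)
  also have "\<dots> = (\<Sum>k. \<Sum>i. ennreal (d k i powr s))"
    by (rule suminf_ennreal_2dimen) simp
  also have "\<dots> \<le> (\<Sum>k. ennreal (\<eta> * (1/2) ^ Suc k))"
    by (intro suminf_le summableI U(4))
  also have "\<dots> = ennreal \<eta>" using \<eta> by (intro suminf_ennreal_half_powers) simp
  finally have "(\<Sum>i. ennreal (d' i powr s)) \<le> ennreal \<eta>" .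
  then show "\<exists>(U :: nat \<Rightarrow> 'a set) d. (\<Union>k. A k) \<subseteq> (\<Union>i. U i) \<and> (\<forall>i. 0 \<le> d i) \<and>
      (\<forall>i. \<forall>x\<in>U i. \<forall>y\<in>U i. dist x y \<le> d i) \<and> (\<Sum>i. ennreal (d i powr s)) \<le> ennreal \<eta>"
    using cov U(2,3) by (intro exI[of _ U'] exI[of _ d']) (auto simp: U'_def d'_def split_beta)
qed

lemma hausdorff_null_countable:
  fixes A :: "'a::euclidean_space set"
  assumes "countable A"
  shows "hausdorff_null s A"
  unfolding hausdorff_null_def
proof (intro allI impI)
  fix \<eta> :: real assume "0 < \<eta>"
  \<comment> \<open>Singletons of size 0 cost nothing because \<open>0 powr s = 0\<close>.\<close>
  have "A \<subseteq> (\<Union>i. {from_nat_into A i})"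
    using from_nat_into_surj[OF assms] by auto
  then show "\<exists>(U :: nat \<Rightarrow> 'a set) d. A \<subseteq> (\<Union>i. U i) \<and> (\<forall>i. 0 \<le> d i) \<and>
      (\<forall>i. \<forall>x\<in>U i. \<forall>y\<in>U i. dist x y \<le> d i) \<and> (\<Sum>i. ennreal (d i powr s)) \<le> ennreal \<eta>"
    by (intro exI[of _ "\<lambda>i. {from_nat_into A i}"] exI[of _ "\<lambda>i. 0"]) auto
qed

lemma hausdorff_null_Un:
  assumes "hausdorff_null s A" "hausdorff_null s B"
  shows "hausdorff_null s (A \<union> B)"
proof -
  have "hausdorff_null s (\<Union>k::nat. if k = 0 then A else B)"
    using assms by (intro hausdorff_null_UN) simp
  moreover have "A \<union> B \<subseteq> (\<Union>k::nat. if k = 0 then A else B)"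
    by (auto split: if_splits intro: exI[of _ 0] exI[of _ 1])
  ultimately show ?thesis by (rule hausdorff_null_subset)
qed

text \<open>The index type is left free so that words can index the covers; the sequence is padded
  with empty sets of size 0.\<close>

lemma hausdorff_null_finite_covers:
  fixes A :: "'a::euclidean_space set"
  assumes "\<And>\<eta>. 0 < \<eta> \<Longrightarrow> \<exists>(W :: 'w set) (U :: 'w \<Rightarrow> 'a set) d. finite W \<and> A \<subseteq> (\<Union>w\<in>W. U w) \<and>
     (\<forall>w\<in>W. 0 \<le> d w) \<and> (\<forall>w\<in>W. \<forall>x\<in>U w. \<forall>y\<in>U w. dist x y \<le> d w) \<and>
     (\<Sum>w\<in>W. d w powr s) \<le> \<eta>"
  shows "hausdorff_null s A"
  unfolding hausdorff_null_def
proof (intro allI impI)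
  fix \<eta> :: real assume "0 < \<eta>"
  from assms[OF this] obtain W :: "'w set" and U :: "'w \<Rightarrow> 'a set" and d where W: "finite W" "A \<subseteq> (\<Union>w\<in>W. U w)"
     "\<And>w. w \<in> W \<Longrightarrow> 0 \<le> d w" "\<And>w. w \<in> W \<Longrightarrow> \<forall>x\<in>U w. \<forall>y\<in>U w. dist x y \<le> d w"
     "(\<Sum>w\<in>W. d w powr s) \<le> \<eta>" by metis
  obtain h where h: "bij_betw h {..<card W} W"
    using ex_bij_betw_nat_finite[OF W(1)] by (auto simp: atLeast0LessThan)
  have hW: "h i \<in> W" if "i < card W" for i using h that by (auto simp: bij_betw_def)
  define U' where "U' i = (if i < card W then U (h i) else {})" for i
  define d' where "d' i = (if i < card W then d (h i) else 0)" for i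
  have "A \<subseteq> (\<Union>i. U' i)"
  proof
    fix x assume "x \<in> A"
    then obtain w where w: "w \<in> W" "x \<in> U w" using W(2) by blast
    then obtain i where "i < card W" "h i = w" using h by (metis bij_betw_imp_surj_on imageE lessThan_iff)
    then have "x \<in> U' i" using w by (simp add: U'_def)
    then show "x \<in> (\<Union>i. U' i)" by blast
  qed
  moreover have "(\<Sum>i. ennreal (d' i powr s)) \<le> ennreal \<eta>"
  proof -
    have "(\<Sum>i. ennreal (d' i powr s)) = (\<Sum>i<card W. ennreal (d' i powr s))"
      by (rule suminf_finite) (auto simp: d'_def)
    also have "\<dots> = (\<Sum>i<card W. ennreal (d (h i) powr s))"
      by (intro sum.cong) (auto simp: d'_def)
    also have "\<dots> = (\<Sum>w\<in>W. ennreal (d w powr s))"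
      by (rule sum.reindex_bij_betw[OF h])
    also have "\<dots> = ennreal (\<Sum>w\<in>W. d w powr s)" by (rule sum_ennreal) simp
    finally show ?thesis using W(5) by (simp add: ennreal_leI)
  qed
  ultimately show "\<exists>(U :: nat \<Rightarrow> 'a set) d. A \<subseteq> (\<Union>i. U i) \<and> (\<forall>i. 0 \<le> d i) \<and>
      (\<forall>i. \<forall>x\<in>U i. \<forall>y\<in>U i. dist x y \<le> d i) \<and> (\<Sum>i. ennreal (d i powr s)) \<le> ennreal \<eta>"
    using W(3,4) hW by (intro exI[of _ U'] exI[of _ d']) (auto simp: U'_def d'_def)
qed

text \<open>Stopping words exist only at positive scales, so size 0 must be avoided. The new sizes
  satisfy \<open>d' i powr s = d i powr s + (\<eta> / 2) * (1/2) ^ Suc i\<close>, which adds \<eta>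
  / 2 in total.\<close>

lemma hausdorff_null_positive_cover:
  fixes A :: "'a::euclidean_space set"
  assumes s: "0 < s" and null: "hausdorff_null s A" and \<eta>: "0 < \<eta>"
  obtains U :: "nat \<Rightarrow> 'a set" and d where "A \<subseteq> (\<Union>i. U i)" "\<forall>i. 0 < d i"
    "\<forall>i. \<forall>x\<in>U i. \<forall>y\<in>U i. dist x y \<le> d i" "(\<Sum>i. ennreal (d i powr s)) \<le> ennreal \<eta>"
proof -
  have "0 < \<eta> / 2" using \<eta> by simp
  then obtain U :: "nat \<Rightarrow> 'a set" and d where U0: "A \<subseteq> (\<Union>i. U i)" "\<forall>i. 0 \<le> d i"
      "\<forall>i. \<forall>x\<in>U i. \<forall>y\<in>U i. dist x y \<le> d i"
      "(\<Sum>i. ennreal (d i powr s)) \<le> ennreal (\<eta> / 2)"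
    by (rule hausdorff_nullE[OF null])
  have U: "A \<subseteq> (\<Union>i. U i)" "\<And>i. 0 \<le> d i"
      "\<And>i x y. x \<in> U i \<Longrightarrow> y \<in> U i \<Longrightarrow> dist x y \<le> d i"
      "(\<Sum>i. ennreal (d i powr s)) \<le> ennreal (\<eta> / 2)"
      by (rule U0(1) U0(2)[rule_format] U0(3)[rule_format] U0(4); assumption)+
  define d' where "d' i = (d i powr s + (\<eta> / 2) * (1/2) ^ Suc i) powr (1 / s)" for i
  have p: "0 < d i powr s + (\<eta> / 2) * (1/2) ^ Suc i" for i
    using \<eta> by (intro add_nonneg_pos) auto
  have d's: "d' i powr s = d i powr s + (\<eta> / 2) * (1/2) ^ Suc i" for i
    using p[of i] s by (simp add: d'_def powr_powr)
  have le: "d i \<le> d' i" for i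
  proof -
    have "d i powr s \<le> d' i powr s" unfolding d's using \<eta> by simp
    moreover have "0 < d' i" using less_imp_neq[OF p[of i]] by (simp only: d'_def powr_gt_zero)
    ultimately show ?thesis using powr_less_mono2[of s "d' i" "d i"] s by linarith
  qed
  have "(\<Sum>i. ennreal (d' i powr s)) =
      (\<Sum>i. ennreal (d i powr s) + ennreal ((\<eta> / 2) * (1/2) ^ Suc i))"
    unfolding d's using \<eta> by (intro suminf_cong ennreal_plus) auto
  also have "\<dots> = (\<Sum>i. ennreal (d i powr s)) + (\<Sum>i. ennreal ((\<eta> / 2) * (1/2) ^ Suc i))"
    by (intro suminf_add[symmetric] summableI)
  also have "\<dots> = (\<Sum>i. ennreal (d i powr s)) + ennreal (\<eta> / 2)"
    using \<eta> by (subst suminf_ennreal_half_powers) auto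
  also have "\<dots> \<le> ennreal (\<eta> / 2) + ennreal (\<eta> / 2)"
    using U(4) by (rule add_right_mono)
  also have "\<dots> = ennreal \<eta>" using \<eta> by (simp flip: ennreal_plus)
  finally have sum: "(\<Sum>i. ennreal (d' i powr s)) \<le> ennreal \<eta>" .
  show thesis
  proof (intro that[of U d'] U(1) sum allI ballI)
    show "0 < d' i" for i using less_imp_neq[OF p[of i]] by (simp only: d'_def powr_gt_zero)
    show "dist x y \<le> d' i" if "x \<in> U i" "y \<in> U i" for i x y
      using U(3)[OF that] le[of i] by linarith
  qed
qed

section \<open>Symbolic coding\<close>

definition word :: "(nat \<Rightarrow> 'a) \<Rightarrow> nat \<Rightarrow> 'a list" where
  "word \<omega> m = map \<omega> [0..<m]"

lemma word_0 [simp]: "word \<omega> 0 = []" by (simp add: word_def)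

lemma word_Suc: "word \<omega> (Suc m) = word \<omega> m @ [\<omega> m]" by (simp add: word_def)

lemma word_Suc_Cons: "word \<omega> (Suc m) = \<omega> 0 # word (\<lambda>k. \<omega> (Suc k)) m"
proof (induction m)
  case (Suc m)
  show ?case unfolding word_Suc[of \<omega> "Suc m"] Suc.IH by (simp add: word_Suc[of _ m])
qed (simp add: word_def)

lemma length_word [simp]: "length (word \<omega> m) = m" by (simp add: word_def)

lemma set_word: "(\<And>k. \<omega> k \<in> A) \<Longrightarrow> set (word \<omega> m) \<subseteq> A" by (auto simp: word_def)

lemma take_word: "k \<le> m \<Longrightarrow> take k (word \<omega> m) = word \<omega> k"
  by (simp add: word_def take_map)

text \<open>The branches are \<open>x \<mapsto> c i * x + d i\<close>, so that \<open>branch_inv i\<close> is the inverse of the \<open>i\<close>-th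
  branch and \<open>foldr branch_inv w\<close> maps \<open>{0..1}\<close> onto the cylinder coded by the word \<open>w\<close>.\<close>

locale pl_map =
  fixes n :: nat and a b c d :: "nat \<Rightarrow> real" and T :: "real \<Rightarrow> real"
  assumes ab: "\<And>i. i \<in> {1..n} \<Longrightarrow> a i < b i"
    and sub: "\<And>i. i \<in> {1..n} \<Longrightarrow> {a i..b i} \<subseteq> {0..1}"
    and disj: "disjoint_family_on (\<lambda>i. interior {a i..b i}) {1..n}"
    and slope_gt: "\<And>i. i \<in> {1..n} \<Longrightarrow> 1 < slope a b i"
    and onto: "\<And>i. i \<in> {1..n} \<Longrightarrow> (\<lambda>x. c i * x + d i) ` {a i..b i} = {0..1}"
    and T: "\<And>x. x \<in> branch_domain n a b \<Longrightarrow> \<exists>i\<in>{1..n}. x \<in> {a i..b i} \<and> T x = c i * x + d i"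
begin

definition l :: "nat \<Rightarrow> real" where "l i = ln (slope a b i)"

definition branch_inv :: "nat \<Rightarrow> real \<Rightarrow> real" where "branch_inv i y = (y - d i) / c i"

text \<open>For words over {1..n}, \<open>exp (- S w)\<close> is the length of the interval
  \<open>cyl w\<close>.\<close>

definition S :: "nat list \<Rightarrow> real" where "S w = sum_list (map l w)"

definition cyl :: "nat list \<Rightarrow> real set" where "cyl w = foldr branch_inv w ` {0..1}"

definition endpoints :: "real set" where
  "endpoints = (\<Union>w. {foldr branch_inv w 0, foldr branch_inv w 1})"

lemma l_pos: "i \<in> {1..n} \<Longrightarrow> 0 < l i"
  using slope_gt[of i] by (simp add: l_def)

lemma exp_l: "i \<in> {1..n} \<Longrightarrow> exp (l i) = slope a b i"
  using slope_gt[of i] by (simp add: l_def)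

text \<open>The preimages of 0 and 1 are at most \<open>b i - a i\<close> apart, so
  \<open>\<bar>c i\<bar> * (b i - a i)\<close> is at least 1; the images of the two ends lie in
  [0,1], so it is at most 1. Equality forces ends onto ends.\<close>

lemma branch_ends:
  assumes i: "i \<in> {1..n}"
  shows "\<bar>c i\<bar> = exp (l i)" "{c i * a i + d i, c i * b i + d i} = {0, 1}"
proof -
  note lt = ab[OF i]
  have mem: "c i * x + d i \<in> {0..1}" if "x \<in> {a i..b i}" for x
    using onto[OF i] that by blast
  have A: "c i * a i + d i \<in> {0..1}" "c i * b i + d i \<in> {0..1}"
    by (rule mem; use lt in simp)+
  have "0 \<in> (\<lambda>x. c i * x + d i) ` {a i..b i}" unfolding onto[OF i] by simp
  then obtain u where u: "u \<in> {a i..b i}" "c i * u + d i = 0" by auto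
  have "1 \<in> (\<lambda>x. c i * x + d i) ` {a i..b i}" unfolding onto[OF i] by simp
  then obtain v where v: "v \<in> {a i..b i}" "c i * v + d i = 1" by auto
  have "1 = c i * (v - u)" using u v by (simp add: algebra_simps)
  also have "\<dots> \<le> \<bar>c i\<bar> * \<bar>v - u\<bar>" by (metis abs_ge_self abs_mult)
  also have "\<dots> \<le> \<bar>c i\<bar> * (b i - a i)" using u v by (intro mult_left_mono) auto
  finally have ge: "1 \<le> \<bar>c i\<bar> * (b i - a i)" .
  have "\<bar>c i\<bar> * (b i - a i) = \<bar>(c i * b i + d i) - (c i * a i + d i)\<bar>"
    using lt by (simp add: abs_mult right_diff_distrib[symmetric])
  then have eq: "\<bar>(c i * b i + d i) - (c i * a i + d i)\<bar> = 1" "\<bar>c i\<bar> * (b i - a i) = 1"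
    using ge A by (auto simp: abs_if split: if_splits)
  show "\<bar>c i\<bar> = exp (l i)"
    using eq(2) lt unfolding exp_l[OF i] slope_def by (simp add: field_simps)
  show "{c i * a i + d i, c i * b i + d i} = {0, 1}"
    using eq(1) A by (auto simp: abs_if split: if_splits)
qed

lemma c_ne: "i \<in> {1..n} \<Longrightarrow> c i \<noteq> 0"
  using branch_ends(1)[of i] by auto

lemma branch_inv_branch: "i \<in> {1..n} \<Longrightarrow> branch_inv i (c i * x + d i) = x"
  using c_ne[of i] by (simp add: branch_inv_def)

lemma branch_branch_inv: "i \<in> {1..n} \<Longrightarrow> c i * branch_inv i y + d i = y"
  using c_ne[of i] by (simp add: branch_inv_def)

lemma branch_inv_mem: "i \<in> {1..n} \<Longrightarrow> y \<in> {0..1} \<Longrightarrow> branch_inv i y \<in> {a i..b i}"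
proof -
  assume i: "i \<in> {1..n}" and y: "y \<in> {0..1}"
  from y obtain x where "x \<in> {a i..b i}" "y = c i * x + d i" unfolding onto[OF i, symmetric] by auto
  then show ?thesis by (simp add: branch_inv_branch[OF i])
qed

lemma branch_inv_mem_open:
  assumes "i \<in> {1..n}" "y \<in> {0<..<1}"
  shows "branch_inv i y \<in> {a i<..<b i}"
proof -
  have m: "branch_inv i y \<in> {a i..b i}" using assms branch_inv_mem by auto
  have "branch_inv i y \<noteq> a i" "branch_inv i y \<noteq> b i"
    using branch_branch_inv[OF assms(1), of y] branch_ends(2)[OF assms(1)] assms(2)
    by (auto simp: doubleton_eq_iff)
  then show ?thesis using m by auto
qed

lemma branch_inv_mem_unit: "i \<in> {1..n} \<Longrightarrow> y \<in> {0..1} \<Longrightarrow> branch_inv i y \<in> {0..1}"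
  using subsetD[OF sub branch_inv_mem] by simp

lemma branch_inv_mem_unit_open: "i \<in> {1..n} \<Longrightarrow> y \<in> {0<..<1} \<Longrightarrow> branch_inv i y \<in> {0<..<1}"
  using branch_inv_mem_open[of i y] sub[of i] ab[of i] by (simp add: atLeastatMost_subset_iff)

lemma open_branch_disjoint:
  assumes "i \<in> {1..n}" "j \<in> {1..n}" "i \<noteq> j"
  shows "{a i<..<b i} \<inter> {a j<..<b j} = {}"
  using disjoint_family_onD[OF disj assms] by simp

text \<open>An open interval disjoint from another one also misses its closure. Hence no choice of
  branch is left at an inner point of a branch interval.\<close>

lemma open_branch_unique:
  assumes "i \<in> {1..n}" "j \<in> {1..n}" "x \<in> {a i<..<b i}" "x \<in> {a j..b j}"
  shows "i = j"
proof (rule ccontr)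
  assume "i \<noteq> j"
  from open_branch_disjoint[OF assms(1,2) this] have e: "{a i<..<b i} \<inter> {a j<..<b j} = {}" .
  have "closure {a j<..<b j} = {a j..b j}" using ab[OF assms(2)] by simp
  then have "{a i<..<b i} \<inter> {a j..b j} = {}"
    using e open_Int_closure_eq_empty[of "{a i<..<b i}" "{a j<..<b j}"] by simp
  with assms show False by blast
qed

lemma T_open: "i \<in> {1..n} \<Longrightarrow> x \<in> {a i<..<b i} \<Longrightarrow> T x = c i * x + d i"
proof -
  assume ix: "i \<in> {1..n}" "x \<in> {a i<..<b i}"
  then have "x \<in> branch_domain n a b" by (force simp: branch_domain_def)
  from T[OF this] obtain j where j: "j \<in> {1..n}" "x \<in> {a j..b j}" "T x = c j * x + d j" by auto
  show ?thesis using open_branch_unique[OF ix(1) j(1) ix(2) j(2)] j(3) by simp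
qed

lemma foldr_branch_inv_affine:
  assumes "set w \<subseteq> {1..n}"
  shows "\<exists>A B. \<bar>A\<bar> = exp (- S w) \<and> (\<forall>y. foldr branch_inv w y = A * y + B)"
  using assms
proof (induction w)
  case Nil
  show ?case by (intro exI[of _ 1] exI[of _ 0]) (simp add: S_def)
next
  case (Cons i w)
  then obtain A B where AB: "\<bar>A\<bar> = exp (- S w)" "\<And>y. foldr branch_inv w y = A * y + B" by auto
  have i: "i \<in> {1..n}" using Cons.prems by simp
  have "- S (i # w) = - S w - l i" by (simp add: S_def)
  then have "\<bar>A / c i\<bar> = exp (- S (i # w))"
    by (simp only: abs_divide branch_ends(1)[OF i] AB(1) exp_diff)
  moreover have "foldr branch_inv (i # w) y = A / c i * y + (B - d i) / c i" for y
    by (simp add: AB branch_inv_def add_divide_distrib diff_divide_distrib)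
  ultimately show ?case by blast
qed

lemma dist_cyl:
  assumes "set w \<subseteq> {1..n}" "x \<in> cyl w" "y \<in> cyl w"
  shows "dist x y \<le> exp (- S w)"
proof -
  obtain A B where AB: "\<bar>A\<bar> = exp (- S w)" "\<And>y. foldr branch_inv w y = A * y + B"
    using foldr_branch_inv_affine[OF assms(1)] by blast
  obtain u v where uv: "u \<in> {0..1}" "v \<in> {0..1}" "x = A * u + B" "y = A * v + B"
    using assms(2,3) AB(2) unfolding cyl_def by auto
  have "dist x y = \<bar>A\<bar> * \<bar>u - v\<bar>"
    by (simp add: uv dist_real_def abs_mult[symmetric] algebra_simps)
  also have "\<dots> \<le> \<bar>A\<bar> * 1" using uv by (intro mult_left_mono) auto
  finally show ?thesis using AB by simp
qed

lemma foldr_branch_inv_mem_open: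
  "set w \<subseteq> {1..n} \<Longrightarrow> y \<in> {0<..<1} \<Longrightarrow> foldr branch_inv w y \<in> {0<..<1}"
proof (induction w)
  case (Cons i w)
  then show ?case using branch_inv_mem_unit_open[of i "foldr branch_inv w y"] by auto
qed simp

lemma foldr_branch_inv_mem:
  "set w \<subseteq> {1..n} \<Longrightarrow> y \<in> {0..1} \<Longrightarrow> foldr branch_inv w y \<in> {0..1}"
proof (induction w)
  case (Cons i w)
  then show ?case using branch_inv_mem_unit[of i "foldr branch_inv w y"] by auto
qed simp

lemma cyl_subset: "set w \<subseteq> {1..n} \<Longrightarrow> cyl w \<subseteq> {0..1}"
  using foldr_branch_inv_mem by (auto simp: cyl_def)

lemma cyl_append: "set v \<subseteq> {1..n} \<Longrightarrow> cyl (w @ v) \<subseteq> cyl w"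
  using cyl_subset[of v] unfolding cyl_def by (auto simp: subset_eq)

lemma countable_endpoints: "countable endpoints"
  unfolding endpoints_def by (intro countable_UN) auto

lemma endpoints_01: "0 \<in> endpoints" "1 \<in> endpoints"
  unfolding endpoints_def by (auto intro!: exI[of _ "[]"])

lemma branch_inv_endpoints: "y \<in> endpoints \<Longrightarrow> branch_inv i y \<in> endpoints"
proof -
  assume "y \<in> endpoints"
  then obtain w where "y = foldr branch_inv w 0 \<or> y = foldr branch_inv w 1"
    by (auto simp: endpoints_def)
  then have "branch_inv i y = foldr branch_inv (i # w) 0 \<or> branch_inv i y = foldr branch_inv (i # w) 1"
    by auto
  then show ?thesis unfolding endpoints_def by blast
qed

text \<open>Stated through cylinders and not through the orbit, so it makes sense at endpoints
  too.\<close>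

definition coded_by :: "real \<Rightarrow> (nat \<Rightarrow> nat) \<Rightarrow> bool" where
  "coded_by x \<omega> \<longleftrightarrow> (\<forall>k. \<omega> k \<in> {1..n}) \<and> (\<forall>m. x \<in> cyl (word \<omega> m))"

lemma coded_by_exists:
  assumes "\<And>k. \<omega> k \<in> {1..n}"
  shows "\<exists>x. coded_by x \<omega>"
proof -
  have "(\<Inter>m. cyl (word \<omega> m)) \<noteq> {}"
  proof (rule compact_nest)
    fix m
    obtain A B where AB: "\<And>y. foldr branch_inv (word \<omega> m) y = A * y + B"
      using foldr_branch_inv_affine[OF set_word, of \<omega>] assms by blast
    have "continuous_on {0..1} (foldr branch_inv (word \<omega> m))"
      unfolding AB by (intro continuous_intros)
    then show "compact (cyl (word \<omega> m))"
      unfolding cyl_def by (intro compact_continuous_image) auto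
    show "cyl (word \<omega> m) \<noteq> {}" by (simp add: cyl_def)
  next
    fix k m :: nat assume "k \<le> m"
    then have "word \<omega> m = word \<omega> k @ drop k (word \<omega> m)"
      by (metis append_take_drop_id take_word)
    moreover have "set (drop k (word \<omega> m)) \<subseteq> {1..n}"
      using set_word[of \<omega>] assms set_drop_subset by (metis order_trans)
    ultimately show "cyl (word \<omega> m) \<subseteq> cyl (word \<omega> k)" by (metis cyl_append)
  qed
  then show ?thesis using assms by (auto simp: coded_by_def)
qed

text \<open>Off \<open>endpoints\<close> the map acts as the shift on codes. The image is again off
  \<open>endpoints\<close>, as \<open>branch_inv\<close> preserves them; in particular it is neither
  0 nor 1, which puts \<open>x\<close> inside its branch interval.\<close>

lemma coded_by_step:
  assumes "coded_by x \<omega>" "x \<notin> endpoints"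
  shows "x \<in> {a (\<omega> 0)<..<b (\<omega> 0)}" "coded_by (T x) (\<lambda>k. \<omega> (Suc k))" "T x \<notin> endpoints"
proof -
  let ?i = "\<omega> 0" let ?y = "c ?i * x + d ?i"
  have i: "?i \<in> {1..n}" and \<omega>: "\<And>k. \<omega> k \<in> {1..n}" using assms by (auto simp: coded_by_def)
  have y: "?y \<in> cyl (word (\<lambda>k. \<omega> (Suc k)) m)" for m
  proof -
    have "x \<in> cyl (word \<omega> (Suc m))" using assms by (auto simp: coded_by_def)
    then obtain u where u: "u \<in> {0..1}" "x = branch_inv ?i (foldr branch_inv (word (\<lambda>k. \<omega> (Suc k)) m) u)"
      unfolding cyl_def word_Suc_Cons by auto
    then have "?y = foldr branch_inv (word (\<lambda>k. \<omega> (Suc k)) m) u"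
      by (simp add: branch_branch_inv[OF i])
    then show ?thesis using u by (auto simp: cyl_def)
  qed
  have x: "x = branch_inv ?i ?y" by (simp add: branch_inv_branch[OF i])
  have ne: "?y \<notin> endpoints" using assms(2) x branch_inv_endpoints by metis
  have "?y \<in> {0..1}" using y[of 0] by (simp add: cyl_def)
  moreover have "?y \<noteq> 0" "?y \<noteq> 1" using ne endpoints_01 by metis+
  ultimately have "?y \<in> {0<..<1}" by auto
  from branch_inv_mem_open[OF i this] x show m: "x \<in> {a ?i<..<b ?i}" by simp
  have "T x = ?y" by (rule T_open[OF i m])
  then show "coded_by (T x) (\<lambda>k. \<omega> (Suc k))" "T x \<notin> endpoints"
    using y \<omega> ne by (auto simp: coded_by_def)
qed

lemma coded_by_orbit:
  assumes "coded_by x \<omega>" "x \<notin> endpoints"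
  shows "(T ^^ k) x \<in> {a (\<omega> k)<..<b (\<omega> k)}"
proof -
  have "coded_by ((T ^^ k) x) (\<lambda>j. \<omega> (k + j)) \<and> (T ^^ k) x \<notin> endpoints"
  proof (induction k)
    case (Suc k)
    then show ?case
      using coded_by_step(2,3)[of "(T ^^ k) x" "\<lambda>j. \<omega> (k + j)"] by simp
  qed (use assms in simp)
  then show ?thesis using coded_by_step(1)[of "(T ^^ k) x" "\<lambda>j. \<omega> (k + j)"] by simp
qed

text \<open>The k-th digit is a branch that \<open>T\<close> really uses at the k-th iterate, so the
  inverse branches lead back from any iterate to \<open>x\<close>, also when \<open>x\<close> is an
  endpoint.\<close>

lemma repeller_coded_by:
  assumes x: "x \<in> repeller (branch_domain n a b) T"
  shows "\<exists>\<omega>. coded_by x \<omega>"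
proof -
  have dom: "(T ^^ k) x \<in> branch_domain n a b" for k
    using x by (auto simp: repeller_def)
  then obtain \<omega> where \<omega>: "\<And>k. \<omega> k \<in> {1..n}" "\<And>k. T ((T ^^ k) x) = c (\<omega> k) * (T ^^ k) x + d (\<omega> k)"
  proof -
    have "\<forall>k. \<exists>i. i \<in> {1..n} \<and> T ((T ^^ k) x) = c i * (T ^^ k) x + d i" using T[OF dom] by blast
    then show ?thesis using that by metis
  qed
  have "x = foldr branch_inv (word \<omega> m) ((T ^^ m) x)" for m
  proof (induction m)
    case (Suc m)
    have "(T ^^ m) x = branch_inv (\<omega> m) ((T ^^ Suc m) x)"
      by (simp add: \<omega>(2) branch_inv_branch[OF \<omega>(1)])
    then show ?case using Suc by (simp add: word_Suc)
  qed simp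
  moreover have "(T ^^ m) x \<in> {0..1}" for m
  proof -
    obtain i where i: "i \<in> {1..n}" "(T ^^ m) x \<in> {a i..b i}"
      using dom[of m] by (auto simp: branch_domain_def)
    show ?thesis by (rule subsetD[OF sub[OF i(1)] i(2)])
  qed
  ultimately have "x \<in> cyl (word \<omega> m)" for m unfolding cyl_def by (metis imageI)
  then show ?thesis using \<omega>(1) by (auto simp: coded_by_def)
qed

lemma T_deriv:
  assumes "i \<in> {1..n}" "x \<in> {a i<..<b i}"
  shows "(T has_real_derivative c i) (at x)"
proof (rule has_field_derivative_transform_within_open[of "\<lambda>x. c i * x + d i" _ _ "{a i<..<b i}"])
  show "((\<lambda>x. c i * x + d i) has_real_derivative c i) (at x)"
    by (auto intro!: derivative_eq_intros)
qed (use assms T_open in auto)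

lemma coded_by_lyapunov:
  assumes cb: "coded_by x \<omega>" and ne: "x \<notin> endpoints"
  shows "x \<in> repeller (branch_domain n a b) T"
    and "has_lyapunov_exponent (branch_domain n a b) T x \<alpha> \<longleftrightarrow>
      (\<lambda>m. S (word \<omega> m) / real m) \<longlonglongrightarrow> \<alpha>"
proof -
  let ?X = "branch_domain n a b"
  have \<omega>: "\<omega> k \<in> {1..n}" for k using cb by (auto simp: coded_by_def)
  note orb = coded_by_orbit[OF cb ne]
  have sub: "{a (\<omega> k)<..<b (\<omega> k)} \<subseteq> ?X" for k using \<omega>[of k] by (force simp: branch_domain_def)
  show "x \<in> repeller ?X T" using subsetD[OF sub orb] by (simp add: repeller_def)
  have der: "((T ^^ m) has_real_derivative (\<Prod>k<m. c (\<omega> k))) (at x)" for m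
  proof (induction m)
    case 0
    show ?case by (simp add: id_def)
  next
    case (Suc m)
    have "((\<lambda>x. T ((T ^^ m) x)) has_real_derivative c (\<omega> m) * (\<Prod>k<m. c (\<omega> k))) (at x)"
      by (rule DERIV_chain2[OF T_deriv[OF \<omega> orb] Suc])
    then show ?case by (simp add: comp_def mult.commute)
  qed
  \<comment> \<open>At an interior point the derivative within the domain is the two-sided one,
    hence unique: every \<open>D\<close> allowed by the definition is the product of the
    \<open>c (\<omega> k)\<close>.\<close>
  have int: "x \<in> interior (iterate_domain ?X T m)" for m
  proof -
    have "\<forall>\<^sub>F y in nhds x. (T ^^ k) y \<in> {a (\<omega> k)<..<b (\<omega> k)}" for k
    proof -
      have "((T ^^ k) \<longlongrightarrow> (T ^^ k) x) (nhds x)"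
        using DERIV_isCont[OF der[of k]] by (simp add: continuous_at tendsto_at_iff_tendsto_nhds)
      then show ?thesis by (rule topological_tendstoD) (use orb[of k] in auto)
    qed
    then have "\<forall>\<^sub>F y in nhds x. \<forall>k<m. (T ^^ k) y \<in> {a (\<omega> k)<..<b (\<omega> k)}"
      using eventually_ball_finite[of "{..<m}" "\<lambda>y k. (T ^^ k) y \<in> {a (\<omega> k)<..<b (\<omega> k)}" "nhds x"]
      by (simp add: Ball_def)
    then have "\<forall>\<^sub>F y in nhds x. y \<in> iterate_domain ?X T m"
    proof (rule eventually_mono)
      fix y assume "\<forall>k<m. (T ^^ k) y \<in> {a (\<omega> k)<..<b (\<omega> k)}"
      then show "y \<in> iterate_domain ?X T m" using sub unfolding iterate_domain_def by blast
    qed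
    then show ?thesis by (auto simp: eventually_nhds interior_def)
  qed
  have lnD: "1 / real m * ln \<bar>D\<bar> = S (word \<omega> m) / real m"
    if "((T ^^ m) has_real_derivative D) (at x within iterate_domain ?X T m)" for D m
  proof -
    have "((T ^^ m) has_real_derivative D) (at x)"
      using that at_within_interior[OF int] by metis
    then have "D = (\<Prod>k<m. c (\<omega> k))" using der by (rule DERIV_unique)
    moreover have "ln \<bar>\<Prod>k<m. c (\<omega> k)\<bar> = S (word \<omega> m)"
    proof (induction m)
      case (Suc m)
      have "\<bar>\<Prod>k<m. c (\<omega> k)\<bar> > 0" using c_ne[OF \<omega>] by simp
      then show ?case using Suc branch_ends(1)[OF \<omega>, of m]
        by (simp add: abs_mult ln_mult word_Suc S_def)
    qed (simp add: S_def)
    ultimately show ?thesis by simp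
  qed
  show "has_lyapunov_exponent ?X T x \<alpha> \<longleftrightarrow> (\<lambda>m. S (word \<omega> m) / real m) \<longlonglongrightarrow> \<alpha>"
  proof
    assume "has_lyapunov_exponent ?X T x \<alpha>"
    then obtain D where D: "\<And>m. ((T ^^ m) has_real_derivative D m) (at x within iterate_domain ?X T m)"
      "(\<lambda>m. 1 / real m * ln \<bar>D m\<bar>) \<longlonglongrightarrow> \<alpha>" unfolding has_lyapunov_exponent_def by blast
    show "(\<lambda>m. S (word \<omega> m) / real m) \<longlonglongrightarrow> \<alpha>" using D(2) unfolding lnD[OF D(1)] .
  next
    assume lim: "(\<lambda>m. S (word \<omega> m) / real m) \<longlonglongrightarrow> \<alpha>"
    have D: "((T ^^ m) has_real_derivative (\<Prod>k<m. c (\<omega> k))) (at x within iterate_domain ?X T m)" for m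
      by (rule has_field_derivative_at_within[OF der])
    show "has_lyapunov_exponent ?X T x \<alpha>"
      unfolding has_lyapunov_exponent_def
      by (rule exI[of _ "\<lambda>m. \<Prod>k<m. c (\<omega> k)"]) (simp only: D lnD[OF D] lim simp_thms)
  qed
qed

end

section \<open>Stopping words and the bounded overlap of their cylinders\<close>

context pl_map
begin

definition ocyl :: "nat list \<Rightarrow> real set" where "ocyl w = foldr branch_inv w ` {0<..<1}"

text \<open>A crude common bound for the \<open>l i\<close>: appending a letter shortens a cylinder
  at most by the factor \<open>exp (- lsum)\<close>.\<close>

definition lsum :: real where "lsum = (\<Sum>i\<in>{1..n}. l i)"

text \<open>\<open>stops \<delta>\<close> cuts every infinite word at the first time at which its cylinder has length at most \<open>\<delta>\<close>.\<close>

definition stops :: "real \<Rightarrow> nat list set" where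
  "stops \<delta> = {w. set w \<subseteq> {1..n} \<and> w \<noteq> [] \<and> exp (- S w) \<le> \<delta> \<and> \<delta> < exp (- S (butlast w))}"

lemma l_nonneg: "i \<in> {1..n} \<Longrightarrow> 0 \<le> l i"
  by (rule less_imp_le[OF l_pos])

lemma l_le_lsum: "i \<in> {1..n} \<Longrightarrow> l i \<le> lsum"
  unfolding lsum_def by (rule member_le_sum) (simp_all add: l_nonneg)

lemma S_append: "S (v @ w) = S v + S w" by (simp add: S_def)

lemma S_nonneg: "set w \<subseteq> {1..n} \<Longrightarrow> 0 \<le> S w"
  unfolding S_def by (intro sum_list_nonneg) (auto intro!: less_imp_le l_pos simp: subset_iff)

lemma S_take_le: "set w \<subseteq> {1..n} \<Longrightarrow> S (take k w) \<le> S w"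
  using S_append[of "take k w" "drop k w"] S_nonneg[of "drop k w"] set_drop_subset[of k w] by auto

lemma S_le: "set w \<subseteq> {1..n} \<Longrightarrow> S w \<le> length w * lsum"
proof (induction w)
  case (Cons i w)
  have "l i \<le> lsum" by (rule l_le_lsum) (use Cons.prems in simp)
  moreover have "S w \<le> length w * lsum" using Cons by simp
  ultimately show ?case by (simp add: S_def algebra_simps)
qed (simp add: S_def)

lemma ocyl_subset_cyl: "ocyl w \<subseteq> cyl w"
  unfolding ocyl_def cyl_def by (intro image_mono) auto

lemma emeasure_ocyl:
  assumes "set w \<subseteq> {1..n}"
  shows "ocyl w \<in> sets lebesgue" "emeasure lebesgue (ocyl w) = ennreal (exp (- S w))"
proof -
  obtain A B where AB: "\<bar>A\<bar> = exp (- S w)" "\<And>y. foldr branch_inv w y = A * y + B"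
    using foldr_branch_inv_affine[OF assms] by blast
  have eq: "ocyl w = (\<lambda>y. A *\<^sub>R y + B) ` {0<..<1}" by (simp add: ocyl_def AB(2))
  have "A \<noteq> 0" using AB(1) by auto
  then have "open ((\<lambda>y. B + A *\<^sub>R y) ` {0<..<1})" by (intro open_affinity) auto
  then have "open (ocyl w)" unfolding eq by (simp add: add.commute)
  then show "ocyl w \<in> sets lebesgue" by simp
  have "emeasure lebesgue (ocyl w) = ennreal (\<bar>A\<bar> ^ DIM(real)) * emeasure lebesgue {0<..<1::real}"
    unfolding eq by (rule emeasure_lebesgue_affine)
  then show "emeasure lebesgue (ocyl w) = ennreal (exp (- S w))" by (simp add: AB(1))
qed

text \<open>Neither word is a prefix of the other, so after removal of common first letters the
  words start in different branches, whose open intervals are disjoint.\<close>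

lemma ocyl_disjoint:
  assumes "set w \<subseteq> {1..n}" "set w' \<subseteq> {1..n}" "take (length w) w' \<noteq> w" "take (length w') w \<noteq> w'"
  shows "ocyl w \<inter> ocyl w' = {}"
  using assms
proof (induction w arbitrary: w')
  case Nil
  then show ?case by simp
next
  case (Cons i w)
  show ?case
  proof (cases w')
    case Nil
    then show ?thesis using Cons.prems by simp
  next
    case w': (Cons j v)
    have ij: "i \<in> {1..n}" "j \<in> {1..n}" and wv: "set w \<subseteq> {1..n}" "set v \<subseteq> {1..n}"
      using Cons.prems w' by auto
    show ?thesis
    proof (cases "i = j")
      case True
      have "inj (branch_inv i)"
        by (rule injI) (metis branch_branch_inv[OF ij(1)])
      moreover have "ocyl w \<inter> ocyl v = {}"
        using Cons.prems w' True by (intro Cons.IH) auto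
      moreover have "ocyl (i # w) = branch_inv i ` ocyl w" "ocyl w' = branch_inv i ` ocyl v"
        using w' True by (auto simp: ocyl_def image_comp comp_def)
      ultimately show ?thesis by (metis image_Int image_empty)
    next
      case False
      have sub: "ocyl (k # u) \<subseteq> {a k<..<b k}" if "k \<in> {1..n}" "set u \<subseteq> {1..n}" for k u
        using branch_inv_mem_open[OF that(1) foldr_branch_inv_mem_open[OF that(2)]]
        unfolding ocyl_def by auto
      show ?thesis using sub[OF ij(1) wv(1)] sub[OF ij(2) wv(2)] open_branch_disjoint[OF ij False] w'
        by blast
    qed
  qed
qed

text \<open>A proper prefix of a stopping word is a prefix of its \<open>butlast\<close>, so its
  cylinder is still longer than \<delta>.\<close>

lemma stops_not_prefix:
  assumes w: "w \<in> stops \<delta>" and w': "w' \<in> stops \<delta>" and ne: "w \<noteq> w'"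
  shows "take (length w) w' \<noteq> w"
proof
  assume eq: "take (length w) w' = w"
  then have "length w < length w'" using ne by (metis leI take_all)
  then have "w = take (length w) (butlast w')" using eq by (simp add: take_butlast)
  then have "S w \<le> S (butlast w')"
    using S_take_le[of "butlast w'" "length w"] w' in_set_butlastD[of _ w'] unfolding stops_def by (auto simp: subset_iff)
  then have "exp (- S (butlast w')) \<le> exp (- S w)" by simp
  then show False using w w' unfolding stops_def mem_Collect_eq by linarith
qed

lemma stops_ge: "w \<in> stops \<delta> \<Longrightarrow> \<delta> * exp (- lsum) \<le> exp (- S w)"
proof -
  assume w: "w \<in> stops \<delta>"
  then have "w \<noteq> []" and lt: "\<delta> < exp (- S (butlast w))" and last: "last w \<in> {1..n}"
    unfolding stops_def using last_in_set by blast+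
  then have "S w = S (butlast w) + l (last w)"
    using S_append[of "butlast w" "[last w]"] by (simp add: S_def)
  then have "exp (- S w) = exp (- S (butlast w)) * exp (- l (last w))"
    by (simp add: exp_add[symmetric])
  also have "\<dots> \<ge> \<delta> * exp (- lsum)"
    using lt l_le_lsum[OF last] by (intro mult_mono) auto
  finally show ?thesis .
qed

text \<open>Packing: the open cylinders are disjoint, have length at least
  \<open>\<delta> * exp (- lsum)\<close> by \<open>stops_ge\<close>, and lie within 2 \<delta> of a
  fixed point of \<open>U\<close>, that is, in an interval of length 4 \<delta>.\<close>

lemma card_stops_le:
  fixes U :: "real set"
  assumes \<delta>: "0 < \<delta>" and U: "\<And>x y. x \<in> U \<Longrightarrow> y \<in> U \<Longrightarrow> dist x y \<le> \<delta>"
  shows "finite {w \<in> stops \<delta>. cyl w \<inter> U \<noteq> {}} \<and>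
         real (card {w \<in> stops \<delta>. cyl w \<inter> U \<noteq> {}}) \<le> 4 * exp lsum"
proof -
  let ?F = "{w \<in> stops \<delta>. cyl w \<inter> U \<noteq> {}}"
  have bound: "real (card G) \<le> 4 * exp lsum" if G: "G \<subseteq> ?F" "finite G" for G
  proof (cases "G = {}")
    case False
    then obtain u where u: "u \<in> U" using G by fastforce
    have Gw: "set w \<subseteq> {1..n}" "w \<in> stops \<delta>" if "w \<in> G" for w
      using that G by (auto simp: stops_def)
    have sub: "ocyl w \<subseteq> {u - 2 * \<delta>..u + 2 * \<delta>}" if w: "w \<in> G" for w
    proof
      fix x assume x: "x \<in> ocyl w"
      obtain v where v: "v \<in> cyl w" "v \<in> U" using w G by blast
      have "dist x v \<le> exp (- S w)" using x ocyl_subset_cyl v by (intro dist_cyl[OF Gw(1)[OF w]]) auto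
      moreover have "exp (- S w) \<le> \<delta>" using Gw(2)[OF w] by (simp add: stops_def)
      moreover have "dist v u \<le> \<delta>" using U v u by blast
      ultimately show "x \<in> {u - 2 * \<delta>..u + 2 * \<delta>}" by (auto simp: dist_real_def)
    qed
    have dis: "disjoint_family_on ocyl G"
      unfolding disjoint_family_on_def
      using ocyl_disjoint[OF Gw(1) Gw(1)] stops_not_prefix[OF Gw(2) Gw(2)] by metis
    have "ennreal (real (card G) * (\<delta> * exp (- lsum))) = (\<Sum>w\<in>G. ennreal (\<delta> * exp (- lsum)))"
      using \<delta> by (simp add: ennreal_mult ennreal_of_nat_eq_real_of_nat)
    also have "\<dots> \<le> (\<Sum>w\<in>G. emeasure lebesgue (ocyl w))"
      by (intro sum_mono) (simp add: emeasure_ocyl(2)[OF Gw(1)] stops_ge[OF Gw(2)] ennreal_leI)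
    also have "\<dots> = emeasure lebesgue (\<Union>w\<in>G. ocyl w)"
      by (rule sum_emeasure[OF _ dis G(2)]) (use emeasure_ocyl(1) Gw(1) in auto)
    also have "\<dots> \<le> emeasure lebesgue {u - 2 * \<delta>..u + 2 * \<delta>}"
      using sub by (intro emeasure_mono) auto
    also have "\<dots> = ennreal (4 * \<delta>)" using \<delta> by simp
    finally have "real (card G) * (\<delta> * exp (- lsum)) \<le> 4 * \<delta>"
      using \<delta> by (simp add: ennreal_le_iff)
    then have "\<delta> * real (card G) \<le> \<delta> * (4 * exp lsum)"
      by (simp add: exp_minus field_simps)
    then show ?thesis using \<delta> by simp
  qed simp
  have "finite ?F \<and> card ?F \<le> nat \<lfloor>4 * exp lsum\<rfloor>"
    using bound by (intro finite_if_finite_subsets_card_bdd) (simp add: le_nat_floor)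
  then show ?thesis using bound[of ?F] by blast
qed

lemma S_word_ge:
  assumes "\<And>k. \<omega> k \<in> {1..n}"
  shows "real m * Min (l ` {1..n}) \<le> S (word \<omega> m)"
proof (induction m)
  case (Suc m)
  have "Min (l ` {1..n}) \<le> l (\<omega> m)" using assms[of m] by (intro Min_le) auto
  then show ?case using Suc by (simp add: word_Suc S_append algebra_simps) (simp add: S_def)
qed (simp add: S_def)

text \<open>\<open>S\<close> grows at least linearly along \<omega>, so there is a first time with
  length at most \<delta>; it is not 0, since the empty word has length 1 > \<delta>.\<close>

lemma exists_word_stops:
  assumes \<omega>: "\<And>k. \<omega> k \<in> {1..n}" and \<delta>: "0 < \<delta>" "\<delta> < 1"
  shows "\<exists>m. word \<omega> m \<in> stops \<delta>"
proof -
  let ?\<mu> = "Min (l ` {1..n})"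
  have \<mu>: "0 < ?\<mu>" using \<omega>[of 0] by (subst Min_gr_iff) (auto intro: l_pos)
  obtain m0 :: nat where "- ln \<delta> / ?\<mu> < real m0" using reals_Archimedean2 by blast
  then have "- ln \<delta> < real m0 * ?\<mu>" using iffD1[OF pos_divide_less_eq[OF \<mu>]] by blast
  then have "- ln \<delta> < S (word \<omega> m0)" using S_word_ge[of \<omega> m0, OF \<omega>] by linarith
  then have "exp (- S (word \<omega> m0)) \<le> exp (ln \<delta>)" by simp
  then have ex: "exp (- S (word \<omega> m0)) \<le> \<delta>" using \<delta> by simp
  define m where "m = (LEAST m. exp (- S (word \<omega> m)) \<le> \<delta>)"
  have m: "exp (- S (word \<omega> m)) \<le> \<delta>" unfolding m_def by (rule LeastI[of "\<lambda>m. exp (- S (word \<omega> m)) \<le> \<delta>", OF ex])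
  have "m \<noteq> 0"
  proof
    assume "m = 0"
    then show False using m \<delta> by (simp add: S_def)
  qed
  then obtain k where k: "m = Suc k" using not0_implies_Suc by blast
  have "\<not> exp (- S (word \<omega> k)) \<le> \<delta>" using not_less_Least[of k "\<lambda>m. exp (- S (word \<omega> m)) \<le> \<delta>"] k m_def by simp
  then have "word \<omega> m \<in> stops \<delta>"
    using m set_word[of \<omega> "{1..n}" m, OF \<omega>] unfolding stops_def by (simp add: k word_Suc)
  then show ?thesis ..
qed

end

section \<open>Bernoulli measures\<close>

context pressure
begin

definition words :: "nat \<Rightarrow> 'i list set" where "words m = {w. set w \<subseteq> I \<and> length w = m}"

abbreviation bsum :: "'i list \<Rightarrow> real" where "bsum w \<equiv> sum_list (map l w)"

definition bern :: "real \<Rightarrow> (nat \<Rightarrow> 'i) measure" where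
  "bern t = PiM (UNIV :: nat set) (\<lambda>_. point_measure I (\<lambda>i. ennreal (exp (t * l i - prs t))))"

lemma finite_words: "finite (words m)"
  unfolding words_def using finite_lists_length_eq[OF fin] by simp

lemma exp_prs: "exp (prs t) = M 0 t"
  using M_pos[of 0 t] by (simp add: prs_def)

text \<open>The sum factorises over the letters. With \<theta> = t it normalises the Bernoulli
  weights; with \<theta> = t + h it is the exponential moment in the Chernoff bound.\<close>

lemma sum_words_exp: "(\<Sum>w\<in>words m. exp (\<theta> * bsum w)) = exp (real m * prs \<theta>)"
proof (induction m)
  case 0
  have "words 0 = {[]}" by (auto simp: words_def)
  then show ?case by simp
next
  case (Suc m)
  have eq: "words (Suc m) = (\<lambda>(i,w). i # w) ` (I \<times> words m)"
    by (auto simp: words_def length_Suc_conv image_iff)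
  have inj: "inj_on (\<lambda>(i,w). i # w) (I \<times> words m)" by (auto simp: inj_on_def)
  have "(\<Sum>w\<in>words (Suc m). exp (\<theta> * bsum w)) =
      (\<Sum>(i,w)\<in>I \<times> words m. exp (\<theta> * l i) * exp (\<theta> * bsum w))"
    unfolding eq sum.reindex[OF inj]
    by (intro sum.cong) (auto simp: exp_add[symmetric] algebra_simps)
  also have "\<dots> = (\<Sum>i\<in>I. exp (\<theta> * l i)) * (\<Sum>w\<in>words m. exp (\<theta> * bsum w))"
    by (simp add: sum.cartesian_product[symmetric] sum_product)
  also have "\<dots> = exp (prs \<theta>) * exp (real m * prs \<theta>)"
    unfolding Suc exp_prs by (simp add: M_def mult.commute)
  finally show ?case by (simp add: exp_add[symmetric] algebra_simps)
qed

lemma product_prob_space_bern: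
  "product_prob_space (\<lambda>_ :: nat. point_measure I (\<lambda>i. ennreal (exp (t * l i - prs t))))"
proof -
  have "(\<Sum>i\<in>I. exp (t * l i - prs t)) = (\<Sum>i\<in>I. exp (l i * t)) / exp (prs t)"
    by (simp add: sum_divide_distrib exp_diff mult.commute)
  also have "\<dots> = 1" unfolding exp_prs using M_pos[of 0 t] by (simp add: M_def)
  finally have 1: "(\<Sum>i\<in>I. exp (t * l i - prs t)) = 1" .
  have "prob_space (point_measure I (\<lambda>i. ennreal (exp (t * l i - prs t))))"
    by (rule prob_spaceI) (simp add: space_point_measure emeasure_point_measure_finite fin 1)
  then show ?thesis by (intro product_prob_spaceI) 
qed

lemma prob_space_bern: "prob_space (bern t)"
proof -
  interpret product_prob_space "\<lambda>_ :: nat. point_measure I (\<lambda>i. ennreal (exp (t * l i - prs t)))" UNIV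
    by (rule product_prob_space_bern)
  show ?thesis unfolding bern_def by (rule P.prob_space_axioms)
qed

lemma space_bern: "\<omega> \<in> space (bern t) \<longleftrightarrow> (\<forall>k. \<omega> k \<in> I)"
  by (auto simp: bern_def space_PiM space_point_measure PiE_iff)

lemma bern_cylinder:
  assumes w: "w \<in> words m"
  shows "{\<omega> \<in> space (bern t). word \<omega> m = w} \<in> sets (bern t)"
    and "emeasure (bern t) {\<omega> \<in> space (bern t). word \<omega> m = w} = ennreal (exp (t * bsum w - real m * prs t))"
proof -
  let ?N = "\<lambda>_ :: nat. point_measure I (\<lambda>i. ennreal (exp (t * l i - prs t)))"
  interpret product_prob_space ?N UNIV by (rule product_prob_space_bern)
  have len: "length w = m" and wI: "\<And>i. i < m \<Longrightarrow> w ! i \<in> I"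
    using w nth_mem by (auto simp: words_def)
  have eq: "{\<omega> \<in> space (bern t). word \<omega> m = w} = {\<omega> \<in> space (PiM UNIV ?N). \<forall>i\<in>{..<m}. \<omega> i \<in> {w ! i}}"
    using len by (auto simp: bern_def word_def list_eq_iff_nth_eq)
  have X: "{w ! i} \<in> sets (?N i)" if "i \<in> {..<m}" for i
    using wI that by (simp add: sets_point_measure)
  show "{\<omega> \<in> space (bern t). word \<omega> m = w} \<in> sets (bern t)"
    unfolding eq unfolding bern_def
  proof (rule sets.sets_Collect_finite_All)
    fix i assume i: "i \<in> {..<m}"
    have "(\<lambda>\<omega>. \<omega> i) -` {w ! i} \<inter> space (PiM UNIV ?N) \<in> sets (PiM UNIV ?N)"
    proof (rule measurable_sets)
      show "(\<lambda>\<omega>. \<omega> i) \<in> PiM UNIV ?N \<rightarrow>\<^sub>M ?N i" by (rule measurable_component_singleton) simp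
      show "{w ! i} \<in> sets (?N i)" by (rule X[OF i])
    qed
    also have "(\<lambda>\<omega>. \<omega> i) -` {w ! i} \<inter> space (PiM UNIV ?N) = {\<omega> \<in> space (PiM UNIV ?N). \<omega> i \<in> {w ! i}}"
      by blast
    finally show "{\<omega> \<in> space (PiM UNIV ?N). \<omega> i \<in> {w ! i}} \<in> sets (PiM UNIV ?N)" .
  qed simp
  have "emeasure (PiM UNIV ?N) {\<omega> \<in> space (PiM UNIV ?N). \<forall>i\<in>{..<m}. \<omega> i \<in> {w ! i}} =
      (\<Prod>i<m. emeasure (?N i) {w ! i})"
    using X by (intro emeasure_PiM_Collect) auto
  also have "\<dots> = (\<Prod>i<m. ennreal (exp (t * l (w ! i) - prs t)))"
  proof (rule prod.cong)
    fix i assume "i \<in> {..<m}"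
    then have "{w ! i} \<subseteq> I" using wI by simp
    then show "emeasure (?N i) {w ! i} = ennreal (exp (t * l (w ! i) - prs t))"
      using emeasure_point_measure_finite[OF fin, of "{w ! i}"] by simp
  qed simp
  also have "\<dots> = ennreal (\<Prod>i<m. exp (t * l (w ! i) - prs t))"
    by (rule prod_ennreal) simp
  also have "(\<Prod>i<m. exp (t * l (w ! i) - prs t)) = exp (\<Sum>i<m. t * l (w ! i) - prs t)"
    by (rule exp_sum[symmetric]) simp
  also have "(\<Sum>i<m. t * l (w ! i) - prs t) = t * bsum w - real m * prs t"
  proof -
    have "bsum w = (\<Sum>i<m. l (w ! i))"
      unfolding sum_list_sum_nth by (simp add: len atLeast0LessThan)
    then show ?thesis by (simp add: sum_subtractf sum_distrib_left)
  qed
  finally show "emeasure (bern t) {\<omega> \<in> space (bern t). word \<omega> m = w} = ennreal (exp (t * bsum w - real m * prs t))"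
    unfolding eq by (simp add: bern_def)
qed

lemma bern_word_in:
  assumes W: "W \<subseteq> words m"
  shows "{\<omega> \<in> space (bern t). word \<omega> m \<in> W} \<in> sets (bern t)"
    and "emeasure (bern t) {\<omega> \<in> space (bern t). word \<omega> m \<in> W} \<le> ennreal (\<Sum>w\<in>W. exp (t * bsum w - real m * prs t))"
proof -
  have finW: "finite W" using finite_subset[OF W finite_words] .
  have eq: "{\<omega> \<in> space (bern t). word \<omega> m \<in> W} = (\<Union>w\<in>W. {\<omega> \<in> space (bern t). word \<omega> m = w})" by auto
  show "{\<omega> \<in> space (bern t). word \<omega> m \<in> W} \<in> sets (bern t)"
    unfolding eq using W finW bern_cylinder(1) by (intro sets.finite_UN) auto
  have "emeasure (bern t) {\<omega> \<in> space (bern t). word \<omega> m \<in> W} \<le>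
      (\<Sum>w\<in>W. emeasure (bern t) {\<omega> \<in> space (bern t). word \<omega> m = w})"
    unfolding eq using W finW bern_cylinder(1) by (intro emeasure_subadditive_finite) auto
  also have "\<dots> = (\<Sum>w\<in>W. ennreal (exp (t * bsum w - real m * prs t)))"
    using W bern_cylinder(2) by (intro sum.cong) auto
  also have "\<dots> = ennreal (\<Sum>w\<in>W. exp (t * bsum w - real m * prs t))" by (rule sum_ennreal) simp
  finally show "emeasure (bern t) {\<omega> \<in> space (bern t). word \<omega> m \<in> W} \<le> ennreal (\<Sum>w\<in>W. exp (t * bsum w - real m * prs t))" .
qed

text \<open>Chernoff bound; \<open>h > 0\<close> gives the upper and \<open>h < 0\<close> the lower deviations.\<close>

lemma chernoff:
  assumes h: "prs (t + h) - prs t - h * mean t \<le> \<bar>h\<bar> * (\<epsilon> / 2)"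
  shows "(\<Sum>w\<in>{w \<in> words m. \<bar>h\<bar> * (real m * \<epsilon>) < h * (bsum w - real m * mean t)}. exp (t * bsum w - real m * prs t))
    \<le> exp (- \<bar>h\<bar> * \<epsilon> / 2) ^ m"
proof -
  let ?B = "{w \<in> words m. \<bar>h\<bar> * (real m * \<epsilon>) < h * (bsum w - real m * mean t)}"
  let ?C = "exp (- (real m * prs t) - h * (real m * mean t) - \<bar>h\<bar> * (real m * \<epsilon>))"
  have "(\<Sum>w\<in>?B. exp (t * bsum w - real m * prs t)) \<le> (\<Sum>w\<in>?B. exp ((t + h) * bsum w) * ?C)"
    by (intro sum_mono) (auto simp: exp_add[symmetric] algebra_simps)
  \<comment> \<open>On the deviation set the inserted factor \<open>exp (h * (bsum w - real m * mean
    t) - \<bar>h\<bar> * (real m * \<epsilon>))\<close> exceeds 1.\<close>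
  also have "\<dots> \<le> (\<Sum>w\<in>words m. exp ((t + h) * bsum w) * ?C)"
    using finite_words by (intro sum_mono2) auto
  also have "\<dots> = exp (real m * prs (t + h)) * ?C"
    by (simp only: sum_distrib_right[symmetric] sum_words_exp)
  also have "\<dots> = exp (real m * (prs (t + h) - prs t - h * mean t - \<bar>h\<bar> * \<epsilon>))"
    by (simp add: exp_add[symmetric] algebra_simps)
  also have "\<dots> \<le> exp (real m * (- \<bar>h\<bar> * \<epsilon> / 2))"
    using h by (simp only: exp_le_cancel_iff) (intro mult_left_mono; simp)
  finally show ?thesis by (simp only: exp_of_nat_mult)
qed

text \<open>As P' = \<open>mean\<close>, the first-order error of P at t is at most
  \<open>\<bar>h\<bar> * (\<epsilon> / 2)\<close> for small h; this uses up half of the Chernoff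
  exponent. One value \<open>\<theta>\<close> and its negative treat the two tails, whence the
  factor 2.\<close>

lemma large_deviations:
  assumes \<epsilon>: "0 < \<epsilon>"
  shows "\<exists>r. 0 < r \<and> r < 1 \<and> (\<forall>m. (\<Sum>w\<in>{w \<in> words m. real m * \<epsilon> < \<bar>bsum w - real m * mean t\<bar>}.
      exp (t * bsum w - real m * prs t)) \<le> 2 * r ^ m)"
proof -
  have lim: "((\<lambda>h. (prs (t + h) - prs t) / h) \<longlongrightarrow> mean t) (at 0)"
    using prs_deriv[of t] by (simp add: DERIV_def)
  obtain s where s: "0 < s" "\<And>h. h \<noteq> 0 \<Longrightarrow> \<bar>h\<bar> < s \<Longrightarrow> \<bar>(prs (t + h) - prs t) / h - mean t\<bar> < \<epsilon> / 2"
  proof -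
    from LIM_D[OF lim, of "\<epsilon> / 2"] \<epsilon> show ?thesis using that by auto
  qed
  have dev: "prs (t + h) - prs t - h * mean t \<le> \<bar>h\<bar> * (\<epsilon> / 2)" if "h \<noteq> 0" "\<bar>h\<bar> < s" for h
  proof -
    have "prs (t + h) - prs t - h * mean t = h * ((prs (t + h) - prs t) / h - mean t)"
      using that by (simp add: field_simps)
    also have "\<dots> \<le> \<bar>h\<bar> * \<bar>(prs (t + h) - prs t) / h - mean t\<bar>"
      by (metis abs_ge_self abs_mult)
    also have "\<dots> \<le> \<bar>h\<bar> * (\<epsilon> / 2)" using s(2)[OF that] by (intro mult_left_mono) auto
    finally show ?thesis .
  qed
  define \<theta> where "\<theta> = s / 2"
  have \<theta>: "0 < \<theta>" "\<theta> < s" using s by (auto simp: \<theta>_def)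
  define r where "r = exp (- \<theta> * \<epsilon> / 2)"
  have "(\<Sum>w\<in>{w \<in> words m. real m * \<epsilon> < \<bar>bsum w - real m * mean t\<bar>}.
      exp (t * bsum w - real m * prs t)) \<le> 2 * r ^ m" for m
  proof -
    let ?A = "\<lambda>h. {w \<in> words m. \<bar>h\<bar> * (real m * \<epsilon>) < h * (bsum w - real m * mean t)}"
    let ?f = "\<lambda>w. exp (t * bsum w - real m * prs t)"
    have "{w \<in> words m. real m * \<epsilon> < \<bar>bsum w - real m * mean t\<bar>} \<subseteq> ?A \<theta> \<union> ?A (- \<theta>)"
    proof
      fix w assume "w \<in> {w \<in> words m. real m * \<epsilon> < \<bar>bsum w - real m * mean t\<bar>}"
      then have w: "w \<in> words m" "real m * \<epsilon> < \<bar>bsum w - real m * mean t\<bar>" by auto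
      from w(2) \<theta>(1) have "\<theta> * (real m * \<epsilon>) < \<theta> * \<bar>bsum w - real m * mean t\<bar>"
        by (rule mult_strict_left_mono)
      then have "\<theta> * (real m * \<epsilon>) < \<theta> * (bsum w - real m * mean t) \<or>
          \<theta> * (real m * \<epsilon>) < - \<theta> * (bsum w - real m * mean t)"
        by (simp add: abs_if right_diff_distrib split: if_splits)
      then show "w \<in> ?A \<theta> \<union> ?A (- \<theta>)" using w(1) \<theta>(1) by auto
    qed
    then have "sum ?f {w \<in> words m. real m * \<epsilon> < \<bar>bsum w - real m * mean t\<bar>} \<le> sum ?f (?A \<theta> \<union> ?A (- \<theta>))"
      using finite_words by (intro sum_mono2) auto
    also have "\<dots> \<le> sum ?f (?A \<theta>) + sum ?f (?A (- \<theta>))"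
      using finite_words by (subst sum.union_inter[symmetric]) (auto intro!: sum_nonneg)
    also have "\<dots> \<le> r ^ m + r ^ m"
      using chernoff[OF dev[of \<theta>], of m] chernoff[OF dev[of "- \<theta>"], of m] \<theta>
      unfolding r_def by (intro add_mono) auto
    finally show ?thesis by simp
  qed
  moreover have "0 < r" "r < 1" using \<theta> \<epsilon> by (auto simp: r_def)
  ultimately show ?thesis by blast
qed

lemma AE_bern_eventually:
  assumes \<epsilon>: "0 < \<epsilon>"
  shows "AE \<omega> in bern t. \<forall>\<^sub>F m in sequentially. \<bar>bsum (word \<omega> m) - real m * mean t\<bar> \<le> real m * \<epsilon>"
proof -
  interpret prob_space "bern t" by (rule prob_space_bern)
  obtain r where r: "0 < r" "r < 1" "\<And>m. (\<Sum>w\<in>{w \<in> words m. real m * \<epsilon> < \<bar>bsum w - real m * mean t\<bar>}.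
      exp (t * bsum w - real m * prs t)) \<le> 2 * r ^ m"
    using large_deviations[OF \<epsilon>] by blast
  let ?A = "\<lambda>m. {\<omega> \<in> space (bern t). word \<omega> m \<in> {w \<in> words m. real m * \<epsilon> < \<bar>bsum w - real m * mean t\<bar>}}"
  have meas: "measure (bern t) (?A m) \<le> 2 * r ^ m" for m
  proof -
    have "emeasure (bern t) (?A m) \<le> ennreal (2 * r ^ m)"
      by (rule order_trans[OF bern_word_in(2)]) (auto intro!: ennreal_leI r(3))
    then show ?thesis using r(1) by (simp add: emeasure_eq_measure)
  qed
  have "AE \<omega> in bern t. \<forall>\<^sub>F m in sequentially. \<omega> \<in> space (bern t) - ?A m"
  proof (rule borel_cantelli_AE1)
    show "?A m \<in> sets (bern t)" for m by (rule bern_word_in) auto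
    show "emeasure (bern t) (?A m) < \<infinity>" for m by (simp add: emeasure_eq_measure)
    show "summable (\<lambda>m. measure (bern t) (?A m))"
      by (rule summable_comparison_test'[of "\<lambda>m. 2 * r ^ m"])
         (use r meas in \<open>auto intro!: summable_mult summable_geometric\<close>)
  qed
  moreover have "word \<omega> m \<in> words m" if "\<omega> \<in> space (bern t)" for \<omega> m
    using that set_word[of \<omega> I m] by (auto simp: space_bern words_def)
  ultimately show ?thesis
    by (auto elim!: eventually_mono)
qed

lemma AE_bern_converges:
  "AE \<omega> in bern t. (\<lambda>m. bsum (word \<omega> m) / real m) \<longlonglongrightarrow> mean t"
proof -
  \<comment> \<open>Countably many tolerances, so that the exceptional null sets can be
    united.\<close>
  have "AE \<omega> in bern t. \<forall>k. \<forall>\<^sub>F m in sequentially.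
      \<bar>bsum (word \<omega> m) - real m * mean t\<bar> \<le> real m * (1 / real (Suc k))"
    by (subst AE_all_countable) (intro allI AE_bern_eventually; simp)
  then show ?thesis
  proof (rule AE_mp, intro AE_I2 impI)
    fix \<omega>
    assume *: "\<forall>k. \<forall>\<^sub>F m in sequentially.
      \<bar>bsum (word \<omega> m) - real m * mean t\<bar> \<le> real m * (1 / real (Suc k))"
    show "(\<lambda>m. bsum (word \<omega> m) / real m) \<longlonglongrightarrow> mean t"
    proof (rule tendstoI)
      fix e :: real assume "0 < e"
      then obtain k where k: "1 / real (Suc k) < e" using nat_approx_posE by blast
      show "\<forall>\<^sub>F m in sequentially. dist (bsum (word \<omega> m) / real m) (mean t) < e"
        using *[rule_format, of k] eventually_gt_at_top[of 0]
      proof eventually_elim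
        case (elim m)
        have "dist (bsum (word \<omega> m) / real m) (mean t) = \<bar>bsum (word \<omega> m) - real m * mean t\<bar> / real m"
        proof -
          have "bsum (word \<omega> m) / real m - mean t = (bsum (word \<omega> m) - real m * mean t) / real m"
            using elim by (simp add: field_simps)
          then show ?thesis by (simp add: dist_real_def)
        qed
        also have "\<dots> \<le> 1 / real (Suc k)"
          using elim by (simp add: divide_le_eq mult.commute)
        finally show ?case using k by simp
      qed
    qed
  qed
qed

end

section \<open>The Lyapunov spectrum\<close>

text \<open>Otherwise the simplifier turns \<open>{1..n}\<close> into \<open>{Suc 0..n}\<close>, and the facts interpreted for the
  index set \<open>{1..n}\<close> no longer match.\<close>

declare One_nat_def [simp del]

locale pl_map_nonconst = pl_map +
  assumes slopes_ne: "\<exists>i\<in>{1..n}. \<exists>j\<in>{1..n}. l i \<noteq> l j"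
begin

sublocale pressure "{1..n}" l
  by unfold_locales (use l_pos slopes_ne in auto)

definition level :: "real \<Rightarrow> real set" where
  "level \<alpha> = {x \<in> repeller (branch_domain n a b) T. has_lyapunov_exponent (branch_domain n a b) T x \<alpha>}"

definition dim :: "real \<Rightarrow> real" where "dim t = prs t / mean t - t"

lemma prs_eq: "prs t = (dim t + t) * mean t"
  using mean_pos[of t] by (simp add: dim_def)

text \<open>Each term alone bounds F(t) from below, so P(t) >= t ln x_i; averaging over the weights
  gives P >= t P'. As \<open>hausdorff_dim\<close> admits only positive exponents, the infimum could
  not reach a negative value.\<close>

lemma dim_nonneg: "0 \<le> dim t"
proof -
  have "t * l i \<le> prs t" if i: "i \<in> {1..n}" for i
  proof -
    have "exp (l i * t) \<le> M 0 t"
      using member_le_sum[of i "{1..n}" "\<lambda>i. exp (l i * t)"] i by (simp add: M_def)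
    then have "exp (t * l i) \<le> exp (prs t)" by (simp add: exp_prs mult.commute)
    then show ?thesis by simp
  qed
  then have "(\<Sum>i\<in>{1..n}. (t * l i) * exp (l i * t)) \<le> (\<Sum>i\<in>{1..n}. prs t * exp (l i * t))"
    by (intro sum_mono mult_right_mono) auto
  then have "t * M 1 t \<le> prs t * M 0 t"
    by (simp add: M_def sum_distrib_left mult.assoc)
  then have "t * mean t \<le> prs t"
    using M_pos[of 0 t] by (simp add: mean_def divide_le_eq)
  then show ?thesis
    using mean_pos[of t] by (simp add: dim_def le_divide_eq)
qed

text \<open>With \<open>P = (s + t) \<alpha>\<close>, a word \<open>w\<close> of length \<open>m\<close> with \<open>S w \<approx> m \<alpha>\<close> has Bernoulli weight
  \<open>exp (t S w - m P) \<approx> exp (- s S w)\<close>, that is, the \<open>s\<close>-th power of the length of its cylinder.\<close>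

lemma weight_ge:
  assumes "dim t < s'" "\<epsilon> = (s' - dim t) * mean t / (2 * (\<bar>s' + t\<bar> + 1))"
    and "\<bar>S w - real m * mean t\<bar> \<le> real m * \<epsilon>"
  shows "exp (- s' * S w) \<le> exp (t * S w - real m * prs t) * exp (- (s' - dim t) * mean t / 2) ^ m"
proof -
  \<comment> \<open>The choice of \<epsilon> lets the deviation cost at most half of the gap
    \<open>(s' - dim t) * mean t\<close> per letter, and the other half remains as decay. The
    summand 1 keeps the denominator positive.\<close>
  have "\<bar>s' + t\<bar> * \<epsilon> \<le> (\<bar>s' + t\<bar> + 1) * \<epsilon>"
    using assms(1,2) mean_pos[of t] by (intro mult_right_mono) auto
  also have "\<dots> = (s' - dim t) * mean t / 2"
  proof -
    have "q * (x / (2 * q)) = x / 2" if "0 < q" for q x :: real using that by simp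
    from this[of "\<bar>s' + t\<bar> + 1"] show ?thesis unfolding assms(2) by simp
  qed
  finally have e: "real m * (\<bar>s' + t\<bar> * \<epsilon>) \<le> real m * ((s' - dim t) * mean t / 2)"
    by (rule mult_left_mono) simp
  have "\<bar>(s' + t) * (S w - real m * mean t)\<bar> \<le> \<bar>s' + t\<bar> * (real m * \<epsilon>)"
    unfolding abs_mult using assms(3) by (intro mult_left_mono) auto
  also have "\<dots> \<le> real m * ((s' - dim t) * mean t / 2)" using e by (simp only: mult.left_commute)
  finally have "- (real m * ((s' - dim t) * mean t / 2)) \<le> (s' + t) * (S w - real m * mean t)"
    by linarith
  moreover have "t * S w - real m * prs t + s' * S w =
      (s' + t) * (S w - real m * mean t) + 2 * (real m * ((s' - dim t) * mean t / 2))"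
  proof -
    have "2 * (real m * ((s' - dim t) * mean t / 2)) = real m * ((s' - dim t) * mean t)" by simp
    then show ?thesis unfolding prs_eq[of t] by (simp only:) (simp add: algebra_simps)
  qed
  moreover have "real m * (- (s' - dim t) * mean t / 2) = - (real m * ((s' - dim t) * mean t / 2))"
    by (simp add: left_diff_distrib right_diff_distrib diff_divide_distrib)
  ultimately have "- s' * S w \<le> t * S w - real m * prs t + real m * (- (s' - dim t) * mean t / 2)"
    by linarith
  then show ?thesis by (simp only: exp_of_nat_mult[symmetric] exp_add[symmetric] exp_le_cancel_iff)
qed

text \<open>The counterpart of \<open>weight_ge\<close> for the lower bound. No decay is required
  here, so the whole gap may be spent on the deviation.\<close>

lemma weight_le:
  assumes "s' < dim t" "\<epsilon> = (dim t - s') * mean t / (\<bar>s' + t\<bar> + 1)"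
    and "\<bar>S w - real m * mean t\<bar> \<le> real m * \<epsilon>"
  shows "exp (t * S w - real m * prs t) \<le> exp (- S w) powr s'"
proof -
  have "\<bar>s' + t\<bar> * \<epsilon> \<le> (\<bar>s' + t\<bar> + 1) * \<epsilon>"
    using assms(1,2) mean_pos[of t] by (intro mult_right_mono) auto
  also have "\<dots> = (dim t - s') * mean t"
    using assms(2) abs_ge_zero[of "s' + t"] by (simp add: add_nonneg_eq_0_iff)
  finally have e: "real m * (\<bar>s' + t\<bar> * \<epsilon>) \<le> real m * ((dim t - s') * mean t)"
    by (rule mult_left_mono) simp
  have "\<bar>(s' + t) * (S w - real m * mean t)\<bar> \<le> \<bar>s' + t\<bar> * (real m * \<epsilon>)"
    unfolding abs_mult using assms(3) by (intro mult_left_mono) auto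
  then have "t * S w - real m * prs t \<le> - S w * s'"
    using e unfolding prs_eq[of t] by (simp add: abs_le_iff algebra_simps)
  then show ?thesis by (simp add: powr_def mult.commute)
qed

text \<open>\<open>B k\<close> fixes the time from which all prefixes are typical, so a single large
  length m covers it. By \<open>weight_ge\<close> the cost is at most \<open>r ^ m\<close> times the
  total Bernoulli weight, which is 1.\<close>

lemma hausdorff_null_level:
  assumes s': "dim t < s'"
  shows "hausdorff_null s' (level (mean t))"
proof -
  let ?\<alpha> = "mean t"
  define \<epsilon> where "\<epsilon> = (s' - dim t) * ?\<alpha> / (2 * (\<bar>s' + t\<bar> + 1))"
  define r where "r = exp (- (s' - dim t) * ?\<alpha> / 2)"
  have \<epsilon>: "0 < \<epsilon>"
    unfolding \<epsilon>_def using s' mean_pos[of t] by (intro divide_pos_pos mult_pos_pos) auto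
  have r: "0 < r" "r < 1" using s' mean_pos[of t] by (auto simp: r_def intro!: mult_neg_pos)
  let ?G = "\<lambda>m. {w \<in> words m. \<bar>S w - real m * ?\<alpha>\<bar> \<le> real m * \<epsilon>}"
  define B where "B k = {x. \<forall>m\<ge>k. \<exists>w\<in>?G m. x \<in> cyl w}" for k
  have "hausdorff_null s' (B k)" for k
  proof (rule hausdorff_null_finite_covers[where 'w = "nat list"])
    fix \<eta> :: real assume \<eta>: "0 < \<eta>"
    have "(\<lambda>m. r ^ m) \<longlonglongrightarrow> 0" using r by (intro LIMSEQ_power_zero) auto
    from order_tendstoD(2)[OF this \<eta>] have "\<forall>\<^sub>F m in sequentially. r ^ m < \<eta> \<and> k \<le> m"
      using eventually_ge_at_top[of k] by eventually_elim simp
    then obtain m where m: "r ^ m < \<eta>" "k \<le> m" by (auto simp: eventually_sequentially)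
    have "(\<Sum>w\<in>?G m. exp (- S w) powr s') \<le> (\<Sum>w\<in>?G m. exp (t * S w - real m * prs t) * r ^ m)"
    proof (rule sum_mono)
      fix w assume w: "w \<in> ?G m"
      have "exp (- S w) powr s' = exp (- s' * S w)" by (simp add: powr_def)
      also have "\<dots> \<le> exp (t * S w - real m * prs t) * r ^ m"
        unfolding r_def by (rule weight_ge[OF s' \<epsilon>_def]) (use w in simp)
      finally show "exp (- S w) powr s' \<le> exp (t * S w - real m * prs t) * r ^ m" .
    qed
    also have "\<dots> \<le> (\<Sum>w\<in>words m. exp (t * S w - real m * prs t) * r ^ m)"
      using finite_words r by (intro sum_mono2) auto
    also have "\<dots> = (\<Sum>w\<in>words m. exp (t * S w)) / exp (real m * prs t) * r ^ m"
      by (simp add: sum_distrib_right sum_divide_distrib exp_diff)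
    also have "\<dots> = r ^ m" using sum_words_exp[where \<theta> = t and m = m, folded S_def] by simp
    finally have sum: "(\<Sum>w\<in>?G m. exp (- S w) powr s') \<le> \<eta>" using m by simp
    have cov: "B k \<subseteq> (\<Union>w\<in>?G m. cyl w)" using m(2) unfolding B_def by blast
    show "\<exists>(W :: nat list set) U d. finite W \<and> B k \<subseteq> (\<Union>w\<in>W. U w) \<and>
     (\<forall>w\<in>W. 0 \<le> d w) \<and> (\<forall>w\<in>W. \<forall>x\<in>U w. \<forall>y\<in>U w. dist x y \<le> d w) \<and>
     (\<Sum>w\<in>W. d w powr s') \<le> \<eta>"
    proof (rule exI[of _ "?G m"], rule exI[of _ cyl], rule exI[of _ "\<lambda>w. exp (- S w)"], intro conjI)
      show "finite (?G m)" using finite_words by simp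
      show "\<forall>w\<in>?G m. \<forall>x\<in>cyl w. \<forall>y\<in>cyl w. dist x y \<le> exp (- S w)"
        using dist_cyl by (auto simp: words_def)
    qed (use cov sum in auto)
  qed
  then have "hausdorff_null s' (endpoints \<union> (\<Union>k. B k))"
    by (intro hausdorff_null_Un hausdorff_null_countable[OF countable_endpoints] hausdorff_null_UN)
  moreover have "level ?\<alpha> \<subseteq> endpoints \<union> (\<Union>k. B k)"
  proof
    fix x assume x: "x \<in> level ?\<alpha>"
    show "x \<in> endpoints \<union> (\<Union>k. B k)"
    proof (cases "x \<in> endpoints")
      case False
      obtain \<omega> where cb: "coded_by x \<omega>" using x repeller_coded_by by (auto simp: level_def)
      have "(\<lambda>m. S (word \<omega> m) / real m) \<longlonglongrightarrow> ?\<alpha>"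
        using x coded_by_lyapunov(2)[OF cb False, of ?\<alpha>] by (simp add: level_def)
      from tendstoD[OF this \<epsilon>] eventually_gt_at_top[of 0]
      have "\<forall>\<^sub>F m in sequentially. \<bar>S (word \<omega> m) - real m * ?\<alpha>\<bar> \<le> real m * \<epsilon>"
      proof eventually_elim
        case (elim m)
        have "real m * dist (S (word \<omega> m) / real m) ?\<alpha> \<le> real m * \<epsilon>"
          using elim by (intro mult_left_mono) auto
        moreover have "\<bar>S (word \<omega> m) - real m * ?\<alpha>\<bar> = real m * dist (S (word \<omega> m) / real m) ?\<alpha>"
        proof -
          have "S (word \<omega> m) - real m * ?\<alpha> = real m * (S (word \<omega> m) / real m - ?\<alpha>)"
            using elim by (simp add: field_simps)
          then show ?thesis by (simp only: dist_real_def abs_mult abs_of_nat)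
        qed
        ultimately show ?case by simp
      qed
      then obtain k where k: "\<And>m. k \<le> m \<Longrightarrow> \<bar>S (word \<omega> m) - real m * ?\<alpha>\<bar> \<le> real m * \<epsilon>"
        unfolding eventually_sequentially by blast
      have "word \<omega> m \<in> words m" for m
        using set_word[of \<omega> "{1..n}" m] cb by (auto simp: coded_by_def words_def)
      then have "x \<in> B k" using k cb unfolding B_def coded_by_def by blast
      then show ?thesis by blast
    qed simp
  qed
  ultimately show ?thesis by (rule hausdorff_null_subset)
qed

text \<open>A mass distribution argument on sequences. Each covering set is replaced by the stopping
  words of its own size whose cylinders meet it: boundedly many, each of weight at most size^s' if
  typical. A cheap cover thus makes \<open>A k\<close> null for every k, while almost every sequence
  lies in some \<open>A k\<close>.\<close>

lemma not_hausdorff_null_level: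
  assumes s': "0 < s'" "s' < dim t"
  shows "\<not> hausdorff_null s' (level (mean t))"
proof
  assume null: "hausdorff_null s' (level (mean t))"
  let ?\<alpha> = "mean t"
  let ?P = "bern t"
  interpret P: prob_space ?P by (rule prob_space_bern)
  define \<epsilon> where "\<epsilon> = (dim t - s') * ?\<alpha> / (\<bar>s' + t\<bar> + 1)"
  have \<epsilon>: "0 < \<epsilon>"
    unfolding \<epsilon>_def using s' mean_pos[of t] by (intro divide_pos_pos mult_pos_pos) auto
  define good where "good = {w :: nat list. \<bar>S w - real (length w) * ?\<alpha>\<bar> \<le> real (length w) * \<epsilon>}"
  define A where "A k = {\<omega> \<in> space ?P. (\<forall>m\<ge>k. word \<omega> m \<in> good) \<and>
      (\<lambda>m. S (word \<omega> m) / real m) \<longlonglongrightarrow> ?\<alpha>}" for k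
  \<comment> \<open>The point coded by a sequence of \<open>A k\<close> may be an endpoint, where
    the digits do not determine the exponent; such points are covered as well.\<close>
  have null': "hausdorff_null s' (level ?\<alpha> \<union> endpoints)"
    by (intro hausdorff_null_Un null hausdorff_null_countable countable_endpoints)
  have cover: "\<exists>C\<in>sets ?P. A k \<subseteq> C \<and> emeasure ?P C \<le> ennreal \<eta>" if \<eta>: "0 < \<eta>" for k \<eta>
  proof -
    \<comment> \<open>By \<open>S_le\<close>, a stopping word at a scale below \<delta>0 has length
      at least k, so it falls under the typicality required in \<open>A k\<close>.\<close>
    define \<delta>0 where "\<delta>0 = exp (- lsum * real (Suc k))"
    have lsum: "0 < lsum"
      using slopes_ne l_pos l_le_lsum by (meson less_le_trans)
    have \<delta>0: "0 < \<delta>0" "\<delta>0 < 1" using lsum by (auto simp: \<delta>0_def)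
    define K0 where "K0 = 4 * exp lsum"
    have K0: "0 < K0" by (simp add: K0_def)
    \<comment> \<open>The first entry yields \<open>K0 * \<eta>' \<le> \<eta>\<close>; the second
      forces every size below \<delta>0, the half making the inequality strict.\<close>
    define \<eta>' where "\<eta>' = min (\<eta> / K0) (\<delta>0 powr s' / 2)"
    have \<eta>': "0 < \<eta>'" using \<eta> \<delta>0 K0 by (simp add: \<eta>'_def)
    obtain U :: "nat \<Rightarrow> real set" and \<delta> where U: "level ?\<alpha> \<union> endpoints \<subseteq> (\<Union>i. U i)"
      "\<forall>i. 0 < \<delta> i" "\<forall>i. \<forall>x\<in>U i. \<forall>y\<in>U i. dist x y \<le> \<delta> i"
      "(\<Sum>i. ennreal (\<delta> i powr s')) \<le> ennreal \<eta>'"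
      by (rule hausdorff_null_positive_cover[OF s'(1) null' \<eta>'])
    have small: "\<delta> i < \<delta>0" for i
    proof -
      have "ennreal (\<delta> i powr s') \<le> ennreal \<eta>'"
      proof (rule order_trans[OF _ U(4)])
        show "ennreal (\<delta> i powr s') \<le> (\<Sum>i. ennreal (\<delta> i powr s'))"
          by (rule leI) (auto dest: ennreal_suminf_lessD)
      qed
      then have "\<delta> i powr s' \<le> \<eta>'" using \<eta>' by simp
      also have "\<eta>' \<le> \<delta>0 powr s' / 2" unfolding \<eta>'_def by (rule min.cobounded2)
      also have "\<dots> < \<delta>0 powr s'" using \<delta>0 by simp
      finally show ?thesis using powr_mono2[of s' \<delta>0 "\<delta> i"] s' \<delta>0 by linarith
    qed
    define W where "W i = {w \<in> stops (\<delta> i). cyl w \<inter> U i \<noteq> {}}" for i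
    have W: "finite (W i)" "real (card (W i)) \<le> K0" for i
      using card_stops_le[of "\<delta> i" "U i"] U(2,3) by (auto simp: W_def K0_def)
    have Ww: "w \<in> words (length w)" "w \<in> stops (\<delta> i)" if "w \<in> W i" for w i
      using that by (auto simp: W_def stops_def words_def)
    let ?C = "\<lambda>w. {\<omega> \<in> space ?P. word \<omega> (length w) = w}"
    define C where "C = (\<Union>i. \<Union>w\<in>W i \<inter> good. ?C w)"
    have Ci: "(\<Union>w\<in>W i \<inter> good. ?C w) \<in> sets ?P" for i
      using W(1)[of i] bern_cylinder(1)[OF Ww(1)] by (intro sets.finite_UN) auto
    have "C \<in> sets ?P" unfolding C_def using Ci by (intro sets.countable_UN) auto
    moreover have "A k \<subseteq> C"
    proof
      fix \<omega> assume \<omega>: "\<omega> \<in> A k"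
      then have sp: "\<omega> \<in> space ?P" and dig: "\<And>j. \<omega> j \<in> {1..n}" by (auto simp: A_def space_bern)
      obtain x where x: "coded_by x \<omega>" using coded_by_exists[of \<omega>] dig by blast
      have "x \<in> level ?\<alpha> \<union> endpoints"
        using coded_by_lyapunov[OF x] \<omega> unfolding level_def A_def by blast
      then obtain i where i: "x \<in> U i" using U(1) by blast
      obtain m where m: "word \<omega> m \<in> stops (\<delta> i)"
        using exists_word_stops[of \<omega> "\<delta> i"] dig U(2)[rule_format, of i] small[of i] \<delta>0 by (meson less_trans)
      have "k \<le> m"
      proof (rule ccontr)
        assume "\<not> k \<le> m"
        have "exp (- S (word \<omega> m)) \<le> \<delta> i" using m by (simp add: stops_def)
        also have "\<delta> i < exp (- lsum * real (Suc k))" using small[of i] by (simp only: \<delta>0_def)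
        finally have "- S (word \<omega> m) < - lsum * real (Suc k)" by (simp only: exp_less_cancel_iff)
        then have "lsum * real (Suc k) < S (word \<omega> m)" by simp
        also have "\<dots> \<le> real m * lsum" using S_le[OF set_word[of \<omega> "{1..n}" m, OF dig]] by simp
        finally show False using \<open>\<not> k \<le> m\<close> lsum by (simp add: mult.commute)
      qed
      then have "word \<omega> m \<in> good" using \<omega> by (simp add: A_def)
      moreover have "x \<in> cyl (word \<omega> m)" using x by (simp add: coded_by_def)
      then have "word \<omega> m \<in> W i" unfolding W_def using m i by blast
      ultimately show "\<omega> \<in> C" unfolding C_def using sp
        by (intro UN_I[of i] UN_I[of "word \<omega> m"]) simp_all
    qed
    moreover have "emeasure ?P C \<le> ennreal \<eta>"
    proof -
      have part: "emeasure ?P (\<Union>w\<in>W i \<inter> good. ?C w) \<le> ennreal K0 * ennreal (\<delta> i powr s')" for i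
      proof -
        have "emeasure ?P (\<Union>w\<in>W i \<inter> good. ?C w) \<le> (\<Sum>w\<in>W i \<inter> good. emeasure ?P (?C w))"
          using W(1)[of i] bern_cylinder(1)[OF Ww(1)] by (intro emeasure_subadditive_finite) auto
        also have "\<dots> \<le> (\<Sum>w\<in>W i \<inter> good. ennreal (\<delta> i powr s'))"
        proof (rule sum_mono)
          fix w assume w: "w \<in> W i \<inter> good"
          have "emeasure ?P (?C w) = ennreal (exp (t * S w - real (length w) * prs t))"
            using bern_cylinder(2)[OF Ww(1), of w i] w by (simp add: S_def)
          also have "\<dots> \<le> ennreal (exp (- S w) powr s')"
            using w by (intro ennreal_leI weight_le[OF s'(2) \<epsilon>_def]) (simp add: good_def)
          also have "\<dots> \<le> ennreal (\<delta> i powr s')"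
            using Ww(2)[of w i] w s' by (intro ennreal_leI powr_mono2) (auto simp: stops_def)
          finally show "emeasure ?P (?C w) \<le> ennreal (\<delta> i powr s')" .
        qed
        also have "\<dots> = ennreal (real (card (W i \<inter> good)) * \<delta> i powr s')"
          by (simp add: ennreal_mult ennreal_of_nat_eq_real_of_nat)
        also have "\<dots> \<le> ennreal (K0 * \<delta> i powr s')"
        proof (intro ennreal_leI mult_right_mono)
          have "card (W i \<inter> good) \<le> card (W i)" by (intro card_mono W) auto
          then show "real (card (W i \<inter> good)) \<le> K0" using W(2)[of i] by linarith
        qed simp
        finally show ?thesis using K0 by (simp add: ennreal_mult)
      qed
      have "emeasure ?P C \<le> (\<Sum>i. emeasure ?P (\<Union>w\<in>W i \<inter> good. ?C w))"
        unfolding C_def using Ci by (intro emeasure_subadditive_countably) auto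
      also have "\<dots> \<le> (\<Sum>i. ennreal K0 * ennreal (\<delta> i powr s'))"
        by (intro suminf_le part summableI)
      also have "\<dots> = ennreal K0 * (\<Sum>i. ennreal (\<delta> i powr s'))" by (rule ennreal_suminf_cmult)
      also have "\<dots> \<le> ennreal K0 * ennreal \<eta>'" by (intro mult_left_mono U(4)) simp
      also have "\<dots> = ennreal (K0 * \<eta>')" using K0 \<eta>' by (simp add: ennreal_mult)
      also have "\<dots> \<le> ennreal \<eta>"
      proof (rule ennreal_leI)
        have "K0 * \<eta>' \<le> K0 * (\<eta> / K0)" using K0 by (intro mult_left_mono) (auto simp: \<eta>'_def)
        then show "K0 * \<eta>' \<le> \<eta>" using K0 by simp
      qed
      finally show ?thesis .
    qed
    ultimately show ?thesis by blast
  qed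
  \<comment> \<open>\<open>A k\<close> is only enclosed in events of probability at most 1 / (j +
    1); their intersection is a measurable null set containing it.\<close>
  have nullA: "AE \<omega> in ?P. \<omega> \<notin> A k" for k
  proof -
    have "\<forall>j. \<exists>C. C \<in> sets ?P \<and> A k \<subseteq> C \<and> emeasure ?P C \<le> ennreal (1 / real (Suc j))"
      using cover[of "1 / real (Suc _)" k] by (metis of_nat_0_less_iff zero_less_Suc zero_less_divide_1_iff)
    then obtain C where C: "\<And>j. C j \<in> sets ?P" "\<And>j. A k \<subseteq> C j"
      "\<And>j. emeasure ?P (C j) \<le> ennreal (1 / real (Suc j))" by metis
    have meas: "(\<Inter>j. C j) \<in> sets ?P" using C(1) by (intro sets.countable_INT) auto
    have "emeasure ?P (\<Inter>j. C j) \<le> 0"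
    proof (rule ennreal_le_epsilon)
      fix e :: real assume "0 < e"
      then obtain j where j: "1 / real (Suc j) < e" using nat_approx_posE by blast
      have "emeasure ?P (\<Inter>j. C j) \<le> emeasure ?P (C j)" using C(1) by (intro emeasure_mono) auto
      also have "\<dots> \<le> ennreal e" using C(3)[of j] j by (meson ennreal_leI less_imp_le order_trans)
      finally show "emeasure ?P (\<Inter>j. C j) \<le> 0 + ennreal e" by simp
    qed
    then have "(\<Inter>j. C j) \<in> null_sets ?P" using meas by (intro null_setsI) auto
    then show ?thesis by (rule AE_I') (use C(2) in auto)
  qed
  then have "AE \<omega> in ?P. \<forall>k. \<omega> \<notin> A k" by (simp add: AE_all_countable)
  moreover have "AE \<omega> in ?P. \<forall>\<^sub>F m in sequentially. \<bar>bsum (word \<omega> m) - real m * ?\<alpha>\<bar> \<le> real m * \<epsilon>"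
    by (rule AE_bern_eventually[OF \<epsilon>])
  moreover have "AE \<omega> in ?P. (\<lambda>m. bsum (word \<omega> m) / real m) \<longlonglongrightarrow> ?\<alpha>"
    by (rule AE_bern_converges)
  moreover have "AE \<omega> in ?P. \<omega> \<in> space ?P" by (rule AE_space)
  ultimately have "AE \<omega> in ?P. False"
  proof eventually_elim
    case (elim \<omega>)
    from elim(2) obtain k where "\<And>m. k \<le> m \<Longrightarrow> \<bar>bsum (word \<omega> m) - real m * ?\<alpha>\<bar> \<le> real m * \<epsilon>"
      unfolding eventually_sequentially by blast
    then have "word \<omega> m \<in> good" if "k \<le> m" for m using that by (simp add: good_def S_def)
    then have "\<omega> \<in> A k" using elim(3,4) by (simp add: A_def S_def)
    then show ?case using elim(1) by blast
  qed
  then show False by simp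
qed

text \<open>Every exponent above \<open>dim t\<close> is admissible and no positive one below it is.
  By \<open>dim_nonneg\<close> those above are positive, so the infimum is correct also if
  \<open>dim t\<close> is 0.\<close>

lemma lyapunov_spectrum_mean:
  "lyapunov_spectrum (branch_domain n a b) T (mean t) = prs t / mean t - t"
proof -
  have "lyapunov_spectrum (branch_domain n a b) T (mean t) =
      Inf {s. 0 < s \<and> hausdorff_null s (level (mean t))}"
    unfolding lyapunov_spectrum_def hausdorff_dim_def level_def[symmetric]
    using hausdorff_measure_0_iff by (intro arg_cong[of _ _ Inf]) blast
  also have "\<dots> = dim t"
  proof (rule cInf_eq)
    fix s assume "s \<in> {s. 0 < s \<and> hausdorff_null s (level (mean t))}"
    then show "dim t \<le> s" using not_hausdorff_null_level[of s t] by force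
  next
    fix y assume y: "\<And>s. s \<in> {s. 0 < s \<and> hausdorff_null s (level (mean t))} \<Longrightarrow> y \<le> s"
    show "y \<le> dim t"
    proof (rule dense_ge)
      fix s assume "dim t < s"
      then show "y \<le> s" using y[of s] hausdorff_null_level[of t s] dim_nonneg[of t] by simp
    qed
  qed
  finally show ?thesis by (simp add: dim_def)
qed

lemma lyapunov_inflections_subset:
  assumes "1 \<le> n"
  shows "lyapunov_inflections n a b T \<subseteq> mean ` {t. 2 * prs t * var t = (mean t)\<^sup>2}"
proof
  fix \<alpha> assume \<alpha>: "\<alpha> \<in> lyapunov_inflections n a b T"
  then have "l 1 < \<alpha>" "\<alpha> < l n" by (auto simp: lyapunov_inflections_def l_def)
  then obtain t where t: "mean t = \<alpha>" using mean_surj[of 1 \<alpha> n] assms by auto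
  have "has_second_derivative (lyapunov_spectrum (branch_domain n a b) T) 0 (mean t)"
    using \<alpha> t by (simp add: lyapunov_inflections_def)
  from inflection_imp[OF lyapunov_spectrum_mean this]
  show "\<alpha> \<in> mean ` {t. 2 * prs t * var t = (mean t)\<^sup>2}" using t by blast
qed

end

lemma real_choose_three: "real (n choose 3) = real n * (real n - 1) * (real n - 2) / 6"
  by (simp add: binomial_gbinomial gbinomial_prod_rev numeral_3_eq_3 prod.atLeast0_lessThan_Suc fact_Suc)

theorem theorem2p1:
  fixes n :: nat and a b :: "nat \<Rightarrow> real" and T :: "real \<Rightarrow> real"
  assumes "n \<ge> 3"
    and "pl_expanding_map n a b T"
  shows "finite (lyapunov_inflections n a b T) \<and>
         real (card (lyapunov_inflections n a b T)) \<le> real n * (real n - 1) * (real n + 4) / 6"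
proof -
  note map = assms(2)[unfolded pl_expanding_map_def]
  obtain c d :: "nat \<Rightarrow> real" where cd:
    "(\<forall>i\<in>{1..n}. (\<lambda>x. c i * x + d i) ` {a i..b i} = {0..1}) \<and>
     (\<forall>x\<in>branch_domain n a b. \<exists>i\<in>{1..n}. x \<in> {a i..b i} \<and> T x = c i * x + d i)"
    using map by (elim conjE exE) (rule that, rule conjI)
  interpret pl_map n a b c d T
  proof (rule pl_map.intro)
    fix i assume i: "i \<in> {1..n}"
    show "a i < b i" "{a i..b i} \<subseteq> {0..1}" using bspec[OF conjunct1[OF map] i] by (rule conjunct1 conjunct2)+
    show "1 < slope a b i" using map i by (elim conjE) (rule bspec)
    show "(\<lambda>x. c i * x + d i) ` {a i..b i} = {0..1}" by (rule bspec[OF conjunct1[OF cd] i])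
  next
    show "disjoint_family_on (\<lambda>i. interior {a i..b i}) {1..n}" using map by (elim conjE)
    show "\<exists>i\<in>{1..n}. x \<in> {a i..b i} \<and> T x = c i * x + d i" if "x \<in> branch_domain n a b" for x
      by (rule bspec[OF conjunct2[OF cd] that])
  qed
  show ?thesis
  proof (cases "\<exists>i\<in>{1..n}. \<exists>j\<in>{1..n}. l i \<noteq> l j")
    case True
    then interpret pl_map_nonconst n a b c d T by unfold_locales
    let ?Z = "{t. 2 * prs t * var t = (mean t)\<^sup>2}"
    have Z: "finite ?Z" "card ?Z \<le> n * (n - 1) + (n choose 3)" using card_zeros_infl by auto
    have sub: "lyapunov_inflections n a b T \<subseteq> mean ` ?Z"
      using lyapunov_inflections_subset assms(1) by simp
    have "card (lyapunov_inflections n a b T) \<le> card (mean ` ?Z)"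
      by (rule card_mono) (use sub Z in auto)
    also have "\<dots> \<le> card ?Z" by (rule card_image_le[OF Z(1)])
    also note Z(2)
    finally have "real (card (lyapunov_inflections n a b T)) \<le> real (n * (n - 1) + (n choose 3))"
      by (rule of_nat_mono)
    also have "\<dots> = real n * (real n - 1) + real n * (real n - 1) * (real n - 2) / 6"
      using assms(1) by (simp add: real_choose_three of_nat_diff)
    also have "\<dots> = real n * (real n - 1) * (real n + 4) / 6" by (simp add: field_simps)
    finally show ?thesis using finite_subset[OF sub] Z(1) by simp
  next
    case False
    \<comment> \<open>With equal slopes the open interval searched for inflections is empty.\<close>
    then have "l 1 = l n" using assms(1) by (metis atLeastAtMost_iff le_trans one_le_numeral order_refl)
    then have "lyapunov_inflections n a b T = {}" by (auto simp: lyapunov_inflections_def l_def)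
    then show ?thesis using assms(1) by simp
  qed
qed

end
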